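(* Let $P,Q\in\mathbb{C}[z,w]$ be coprime polynomials with $Q(0,0)\neq 0$, and let $$F(z,w)=\frac{P(z,w)}{Q(z,w)}=\sum_{x,y\ge 0} f(x,y)z^xw^y$$ be the Taylor expansion at the origin. Assume: (I) $Q=\prod_{i=1}^m Q_i$ with $Q_i(z,w)=1-a_iz-b_iw$; (II) among the complex lines $\mathcal V_i=\{(z,w)\in\mathbb{C}^2: Q_i(z,w)=0\}$, $i=1,\dots,m$, any two intersect in exactly one point, and no three have a common point; (III) $a_i$ and $b_i$ are positive real numbers for all $i=1,\dots,m$. Let $M$ be the polygon $\{(z,w)\in\mathbb{R}^2: z>0,\ w>0,\ Q_i(z,w)>0,\ i=1,\dots,m\}$, and assume that $P\neq 0$ at every vertex of $M$ that does not lie on the coordinate axes. Then for almost all $(p,q)\in\mathbb{Z}_+^2$, on the diagonal $x=kp$, $y=kq$, $k\in\mathbb{Z}_+$, one has as $k\to+\infty$ $$f(x,y)\sim C(p,q;k)\,\frac{P(\hat z,\hat w)}{\hat z^{\,x+1}\hat w^{\,y+1}},$$ where: - if $(p,q)\in\operatorname{Int}K_i$, then $(\hat z,\hat w)=(z_i,w_i)$ and $C(p,q;k)=\dfrac{\mathrm{const}(p,q)}{\sqrt k}$, with $\mathrm{const}(p,q)$ independent of $k$; - if $(p,q)\in\operatorname{Int}\Omega_{ij}$, then $(\hat z,\hat w)=(z_{ij},w_{ij})$ and $C(p,q;k)$ is a constant independent of $p,q,k$ (it depends only on $F$ and on the cone $\Omega_{ij}$). The points $(z_i,w_i)$, $(z_{ij},w_{ij})$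 and the cones $K_i,\Omega_{ij}$ are those defined in the context.
   Context: $\mathbb{Z}_+$ denotes the nonnegative integers and $\mathbb{R}^2_+$ the set of pairs of nonnegative reals. The notation $g(k)\sim h(k)$ as $k\to+\infty$ means $g(k)/h(k)\to1$. For $(p,q)$ with $p,q>0$ and $i=1,\dots,m$, the point $(z_i,w_i)=\left(\frac1{a_i}\frac p{p+q},\frac1{b_i}\frac q{p+q}\right)$ is the solution of $Q_i=0$, $q z\,\partial_zQ_i-p w\,\partial_wQ_i=0$; it depends on $(p,q)$. For $i\ne j$ in $\{1,\dots,m\}$, $(z_{ij},w_{ij})$ is the unique solution of $Q_i=Q_j=0$ (here $\Delta_{ij}=a_ib_j-a_jb_i\neq0$). The cones are $$K_i=\{(p,q)\in\mathbb{R}^2_+:\max_{\overline M} z^pw^q=\max_{\mathcal V_i\cap\mathbb{R}^2_+}z^pw^q=z_i^pw_i^q\},$$ $$\Omega_{ij}=\{(p,q)\in\mathbb{R}^2_+:\max_{\overline M} z^pw^q=z_{ij}^pw_{ij}^q\},$$ where $\overline M$ is the closure of $M$, and $\Omega_{ij}$ is considered only for pairs with $z_{ij}>0$, $w_{ij}>0$. Their union is $\mathbb{R}^2_+$; some of them may be empty, and nonempty ones can meet only along boundary rays. $\operatorname{Int}$ denotes the interior in $\mathbb{R}^2$. "Almost all $(p,q)\in\mathbb{Z}_+^2$" means all $(p,q)\in\mathbb{Z}^2_+$ outside a finite union of rays issuing from the origin; such $(p,q)$ lie in the interior of one of the cones $K_i$, $\Omega_{ij}$. *)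

theory Defs
  imports "HOL-Analysis.Analysis" "HOL-Computational_Algebra.Polynomial_Factorial"
begin

(* C[z,w] is represented as C[z][w]: the coefficients of the outer polynomial are
   polynomials in z. *)
definition eval2 :: "complex poly poly \<Rightarrow> complex \<Rightarrow> complex \<Rightarrow> complex" where
  "eval2 P z w = poly (poly P [:w:]) z"

definition lin_poly :: "real \<Rightarrow> real \<Rightarrow> complex poly poly" where
  "lin_poly \<alpha> \<beta> = [:[:1, - of_real \<alpha>:], [:- of_real \<beta>:]:]"

lemma eval2_lin_poly:
  "eval2 (lin_poly \<alpha> \<beta>) z w = 1 - of_real \<alpha> * z - of_real \<beta> * w"
  by (simp add: eval2_def lin_poly_def algebra_simps)

definition cline :: "real \<Rightarrow> real \<Rightarrow> (complex \<times> complex) set" where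
  "cline \<alpha> \<beta> = {(z, w). eval2 (lin_poly \<alpha> \<beta>) z w = 0}"

(* The sum is over all pairs (x,y) without ordering, so convergence is absolute. *)
definition taylor_coeffs_at_origin ::
    "(nat \<Rightarrow> nat \<Rightarrow> complex) \<Rightarrow> (complex \<Rightarrow> complex \<Rightarrow> complex) \<Rightarrow> bool" where
  "taylor_coeffs_at_origin f F \<longleftrightarrow>
     (\<forall>\<^sub>F (z, w) in nhds (0, 0). ((\<lambda>(x, y). f x y * z ^ x * w ^ y) has_sum F z w) UNIV)"

definition polygon_M :: "nat \<Rightarrow> (nat \<Rightarrow> real) \<Rightarrow> (nat \<Rightarrow> real) \<Rightarrow> (real \<times> real) set" where
  "polygon_M m a b = {(z, w). z > 0 \<and> w > 0 \<and> (\<forall>i\<in>{1..m}. 1 - a i * z - b i * w > 0)}"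

definition line_point :: "real \<Rightarrow> real \<Rightarrow> real \<times> real \<Rightarrow> real \<times> real" where
  "line_point \<alpha> \<beta> = (\<lambda>(p, q). (1 / \<alpha> * (p / (p + q)), 1 / \<beta> * (q / (p + q))))"

(* The common point of two such lines is real, since their coefficients are. *)
definition crossing_point ::
    "(nat \<Rightarrow> real) \<Rightarrow> (nat \<Rightarrow> real) \<Rightarrow> nat \<Rightarrow> nat \<Rightarrow> real \<times> real" where
  "crossing_point a b i j =
     (THE (z, w). 1 - a i * z - b i * w = 0 \<and> 1 - a j * z - b j * w = 0)"

(* z^p w^q on the closed quadrant, with 0^0 = 1 (whereas 0 powr 0 = 0). *)
definition rmonomial :: "real \<times> real \<Rightarrow> real \<times> real \<Rightarrow> real" where
  "rmonomial = (\<lambda>(p, q) (z, w). (if p = 0 then 1 else z powr p) * (if q = 0 then 1 else w powr q))"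

definition has_max :: "('a \<Rightarrow> real) \<Rightarrow> 'a set \<Rightarrow> real \<Rightarrow> bool" where
  "has_max g S v \<longleftrightarrow> v \<in> g ` S \<and> (\<forall>s\<in>S. g s \<le> v)"

definition cone_K :: "nat \<Rightarrow> (nat \<Rightarrow> real) \<Rightarrow> (nat \<Rightarrow> real) \<Rightarrow> nat \<Rightarrow> (real \<times> real) set" where
  "cone_K m a b i = {(p, q). p \<ge> 0 \<and> q \<ge> 0 \<and>
     has_max (rmonomial (p, q)) (closure (polygon_M m a b))
       (rmonomial (p, q) (line_point (a i) (b i) (p, q))) \<and>
     has_max (rmonomial (p, q))
       {(z, w). z \<ge> 0 \<and> w \<ge> 0 \<and> (of_real z, of_real w) \<in> cline (a i) (b i)}
       (rmonomial (p, q) (line_point (a i) (b i) (p, q)))}"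

(* Meaningful only when both coordinates of the crossing point are positive. *)
definition cone_Omega ::
    "nat \<Rightarrow> (nat \<Rightarrow> real) \<Rightarrow> (nat \<Rightarrow> real) \<Rightarrow> nat \<Rightarrow> nat \<Rightarrow> (real \<times> real) set" where
  "cone_Omega m a b i j = {(p, q). p \<ge> 0 \<and> q \<ge> 0 \<and>
     has_max (rmonomial (p, q)) (closure (polygon_M m a b))
       (rmonomial (p, q) (crossing_point a b i j))}"

(* The index pairs for which cone_Omega is considered. *)
definition Omega_pairs :: "nat \<Rightarrow> (nat \<Rightarrow> real) \<Rightarrow> (nat \<Rightarrow> real) \<Rightarrow> (nat \<times> nat) set" where
  "Omega_pairs m a b = {(i, j). i \<in> {1..m} \<and> j \<in> {1..m} \<and> i \<noteq> j \<and>
     fst (crossing_point a b i j) > 0 \<and> snd (crossing_point a b i j) > 0}"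

definition origin_ray :: "real \<times> real \<Rightarrow> (real \<times> real) set" where
  "origin_ray d = {t *\<^sub>R d | t. t \<ge> 0}"

(* g(k)/h(k) tends to 1.  Unlike asymp_equiv, the quotient 0/0 does not count as 1, so h
   has to be eventually nonzero; this rules out vanishing constants in the main term. *)
definition ratio_equiv :: "(nat \<Rightarrow> complex) \<Rightarrow> (nat \<Rightarrow> complex) \<Rightarrow> bool" where
  "ratio_equiv g h \<longleftrightarrow> (\<lambda>k. g k / h k) \<longlonglongrightarrow> 1"

definition main_term :: "complex poly poly \<Rightarrow> real \<times> real \<Rightarrow> nat \<Rightarrow> nat \<Rightarrow> complex" where
  "main_term P = (\<lambda>(z, w) x y.
     eval2 P (of_real z) (of_real w) / (of_real z ^ (x + 1) * of_real w ^ (y + 1)))"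

end

(* Writing the factor 1/Q_i as the series of (x+y choose x) a_i^x b_i^y z^x w^y, the coefficients f are
   convolutions of these with the coefficients of P / prod_{j \<noteq> i} Q_j, whose series converges
   absolutely beyond (z_i, w_i) when that point lies on the boundary of M and on no other line.
   Rescaled by (z_i, w_i), the binomial kernel behaves like const / sqrt k by Stirling's formula, and
   dominated convergence transfers this to f. At a vertex (z_ij, w_ij) the kernel is that of
   1/(Q_i Q_j); as Q_j - Q_i becomes a multiple of z - w after rescaling, its coefficients are
   differences of binomial tail probabilities, which tend to a nonzero constant by Chebyshev's
   inequality when p/(p+q) lies strictly between a_i z_ij and a_j z_ij. *)

theory Submission
  imports Defs "HOL-Real_Asymp.Real_Asymp" "HOL-Complex_Analysis.Cauchy_Integral_Formula"
begin

section \<open>Double power series\<close>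

text \<open>Dominated convergence needs a bound on the shifted kernel valid for all shifts at once,
  including those as long as k itself, for which neighbouring coefficients are no longer comparable.
  A growth factor \<rho> ^ (s + t) with some \<rho> > 1 can be afforded, because the series of P
  over the remaining factors still converges absolutely at the point dilated by \<rho>. Short shifts
  are controlled by quotients of neighbouring coefficients, long ones because \<rho> ^ (s + t)
  outgrows sqrt k. The excluded rays have three origins: the coordinate axes, the directions whose
  tangency point on one line lies on another line too, and the directions for which P vanishes at a
  tangency point. The last are finitely many because coprimality keeps P from vanishing identically
  on a line. The cones are defined by the value of a maximum and not by its place. For a vertex,
  only the openness of the interior of the cone forces the crossing point into the polygon;
  convexity then gives the position of p / (p + q) between the two lines.\<close>

definition dps_sums :: "(nat \<Rightarrow> nat \<Rightarrow> complex) \<Rightarrow> complex \<Rightarrow> complex \<Rightarrow> complex \<Rightarrow> bool" where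
  "dps_sums f z w S \<longleftrightarrow> ((\<lambda>(x, y). f x y * z ^ x * w ^ y) has_sum S) UNIV"

text \<open>The summation index sits on the second factor: later the first factor is the kernel,
  whose backward shifts are compared with each other, and the second is a fixed series. The ring is
  left open because kernels are also convolved over the reals.\<close>

definition conv :: "(nat \<Rightarrow> nat \<Rightarrow> 'a) \<Rightarrow> (nat \<Rightarrow> nat \<Rightarrow> 'a) \<Rightarrow> nat \<Rightarrow> nat \<Rightarrow> 'a :: comm_semiring_1" where
  "conv f g x y = (\<Sum>(s, t)\<in>{..x} \<times> {..y}. f (x - s) (y - t) * g s t)"

text \<open>Unordered summability of complex numbers is already absolute, so the product family is
  absolutely summable over the rectangle, as Fubini requires.\<close>

lemma has_sum_complex_times:
  fixes F :: "'a \<Rightarrow> complex" and G :: "'b \<Rightarrow> complex"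
  assumes F: "(F has_sum S) A" and G: "(G has_sum T) B"
  shows "((\<lambda>(p, q). F p * G q) has_sum (S * T)) (A \<times> B)"
proof (rule has_sum_SigmaI)
  show "((\<lambda>q. case (p, q) of (p, q) \<Rightarrow> F p * G q) has_sum F p * T) B" for p
    using has_sum_cmult_right[OF G] by simp
  show "((\<lambda>p. F p * T) has_sum S * T) A"
    using has_sum_cmult_left[OF F] by simp
  have nF: "(\<lambda>p. norm (F p)) summable_on A" and nG: "(\<lambda>p. norm (G p)) summable_on B"
    using F G has_sum_imp_summable summable_on_iff_abs_summable_on_complex by blast+
  have "(\<lambda>u. norm (case u of (p, q) \<Rightarrow> F p * G q)) summable_on A \<times> B"
    unfolding Infinite_Sum.abs_summable_on_Sigma_iff
    using summable_on_cmult_right[OF nG] summable_on_cmult_left[OF nF]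
    by (auto simp: norm_mult infsum_cmult_right' infsum_nonneg abs_mult abs_of_nonneg)
  then show "(\<lambda>(p, q). F p * G q) summable_on A \<times> B"
    using abs_summable_summable by blast
qed

text \<open>The absolutely summable product family is regrouped by total exponent; every fibre is a
  finite rectangle.\<close>

lemma dps_sums_conv:
  assumes "dps_sums f z w S" "dps_sums g z w T"
  shows "dps_sums (conv f g) z w (S * T)"
proof -
  let ?F = "\<lambda>(x, y). f x y * z ^ x * w ^ y" and ?G = "\<lambda>(x, y). g x y * z ^ x * w ^ y"
  let ?h = "\<lambda>((x, y), (s, t)). (f (x - s) (y - t) * g s t) * z ^ x * w ^ y"
  have "((\<lambda>(p, q). ?F p * ?G q) has_sum (S * T)) (UNIV \<times> UNIV)"
    using assms unfolding dps_sums_def by (rule has_sum_complex_times)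
  also have "?this \<longleftrightarrow> (?h has_sum (S * T)) (SIGMA (x, y):UNIV. {..x} \<times> {..y})"
    by (rule has_sum_reindex_bij_witness[where
          i = "\<lambda>((x, y), (s, t)). ((x - s, y - t), (s, t))" and
          j = "\<lambda>((x, y), (s, t)). ((x + s, y + t), (s, t))"])
       (auto simp: power_add algebra_simps)
  finally have *: "(?h has_sum (S * T)) (SIGMA (x, y):UNIV. {..x} \<times> {..y})" .
  show ?thesis
    unfolding dps_sums_def
  proof (rule has_sum_SigmaD[OF *])
    show "((\<lambda>v. ?h (u, v)) has_sum (case u of (x, y) \<Rightarrow> conv f g x y * z ^ x * w ^ y))
            (case u of (x, y) \<Rightarrow> {..x} \<times> {..y})" for u :: "nat \<times> nat"
      by (auto simp: conv_def case_prod_unfold sum_distrib_right intro!: has_sum_finiteI)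
  qed
qed

section \<open>Uniqueness of Taylor coefficients\<close>

lemma powser_all_zero:
  fixes c :: "nat \<Rightarrow> complex"
  assumes "r > 0" and "\<And>z. norm z < r \<Longrightarrow> (\<lambda>n. c n * z ^ n) sums 0"
  shows "c n = 0"
proof (rule ccontr)
  assume "c n \<noteq> 0"
  \<comment> \<open>Isolation of zeros is used below through a nonvanishing coefficient of positive
    index, so the constant term is settled separately by evaluation at 0.\<close>
  have "c 0 = 0"
    using assms(2)[of 0] \<open>r > 0\<close> by simp
  with \<open>c n \<noteq> 0\<close> have "n > 0"
    by (cases n) auto
  show False
  proof (rule powser_0_nonzero[of r 0 c "\<lambda>_. 0" n])
    fix s :: real
    assume "s > 0" and "\<And>z :: complex. z \<in> cball 0 s - {0} \<Longrightarrow> (0 :: complex) \<noteq> 0"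
    from this(2)[of "of_real s"] \<open>s > 0\<close> show False
      by auto
  qed (use assms \<open>c n \<noteq> 0\<close> \<open>n > 0\<close> in simp_all)
qed

text \<open>The one-variable case applies twice: for fixed w the row sums are the coefficients of a
  power series in z, and each row sum is itself a power series in w.\<close>

lemma dps_sums_all_zero:
  assumes "r > 0" and h: "\<And>z w. norm z < r \<Longrightarrow> norm w < r \<Longrightarrow> dps_sums h z w 0"
  shows "h x y = 0"
proof -
  have inner: "(\<lambda>y. h x y * w ^ y) summable_on UNIV \<and> infsum (\<lambda>y. h x y * w ^ y) UNIV = 0"
    if w: "norm w < r" for x w
  proof -
    have sm: "(\<lambda>y. h x y * w ^ y) summable_on UNIV" for x
    proof -
      \<comment> \<open>Any nonzero z in the disc would do: a row of the summable double family,
        divided by \<open>z ^ x\<close>, is the row without z.\<close>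
      define z :: complex where "z = of_real (r / 2)"
      have z: "norm z < r" "z \<noteq> 0"
        using \<open>r > 0\<close> by (auto simp: z_def)
      have "(\<lambda>(x, y). h x y * z ^ x * w ^ y) summable_on UNIV \<times> UNIV"
        using h[OF z(1) w] has_sum_imp_summable by (auto simp: dps_sums_def)
      from summable_on_SigmaD1[OF this, of x]
      have "(\<lambda>y. z ^ x * (h x y * w ^ y)) summable_on UNIV"
        by (simp add: mult_ac)
      then show ?thesis
        using z by (simp add: summable_on_cmult_right')
    qed
    have "(\<lambda>x. infsum (\<lambda>y. h x y * w ^ y) UNIV * z ^ x) sums 0" if z: "norm z < r" for z
    proof (rule has_sum_imp_sums, rule has_sum_SigmaD)
      show "((\<lambda>(x, y). h x y * z ^ x * w ^ y) has_sum 0) (UNIV \<times> UNIV)"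
        using h[OF z w] by (simp add: dps_sums_def)
      show "((\<lambda>y. case (x, y) of (x, y) \<Rightarrow> h x y * z ^ x * w ^ y) has_sum
              infsum (\<lambda>y. h x y * w ^ y) UNIV * z ^ x) UNIV" for x
        using has_sum_cmult_left[OF has_sum_infsum[OF sm[of x]], of "z ^ x"] by (simp add: mult_ac)
    qed
    from powser_all_zero[OF \<open>r > 0\<close> this] sm show ?thesis
      by blast
  qed
  have "(\<lambda>y. h x y * w ^ y) sums 0" if "norm w < r" for w
    using inner[OF that] has_sum_infsum has_sum_imp_sums by metis
  from powser_all_zero[OF \<open>r > 0\<close> this] show ?thesis .
qed

text \<open>Both coefficient identities needed later, for f itself and for the kernel of two lines,
  come from equalities of functions near the origin.\<close>

lemma dps_sums_unique:
  assumes "\<forall>\<^sub>F (z, w) in nhds (0, 0). dps_sums f z w (F z w)"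
    and "\<forall>\<^sub>F (z, w) in nhds (0, 0). dps_sums g z w (F z w)"
  shows "f = g"
proof -
  have "\<forall>\<^sub>F (z, w) in nhds (0, 0). dps_sums (\<lambda>x y. f x y - g x y) z w 0"
    using assms
  proof eventually_elim
    case (elim u)
    obtain z w where u: "u = (z, w)"
      by force
    show ?case
      using has_sum_add[of "\<lambda>(x, y). f x y * z ^ x * w ^ y" UNIV "F z w"
          "\<lambda>(x, y). - (g x y * z ^ x * w ^ y)" "- F z w"] elim
      by (auto simp: u dps_sums_def case_prod_unfold algebra_simps has_sum_uminus)
  qed
  then obtain S where S: "open S" "(0, 0) \<in> S"
    "\<And>z w. (z, w) \<in> S \<Longrightarrow> dps_sums (\<lambda>x y. f x y - g x y) z w 0"
    unfolding eventually_nhds by auto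
  obtain e where e: "e > 0" "ball (0, 0) e \<subseteq> S"
    using S openE by blast
  have "f x y - g x y = 0" for x y
  proof (rule dps_sums_all_zero[of "e / 2"])
    fix z w :: complex
    assume "norm z < e / 2" "norm w < e / 2"
    then have "dist (0, 0) (z, w) < e"
      using norm_Pair_le[of "- z" "- w"] by (simp add: dist_norm)
    then show "dps_sums (\<lambda>x y. f x y - g x y) z w 0"
      using e S(3) by auto
  qed (use e in auto)
  then show ?thesis
    by (auto simp: fun_eq_iff)
qed

lemma dps_sums_poly: "dps_sums (\<lambda>x y. coeff (coeff P y) x) z w (eval2 P z w)"
proof -
  \<comment> \<open>The outer variable is w, so the support is listed with y first and then
    flipped.\<close>
  define B where "B = (\<lambda>(y, x). (x, y)) ` (SIGMA y:{..degree P}. {..degree (coeff P y)})"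
  have "eval2 P z w = (\<Sum>y\<le>degree P. \<Sum>x\<le>degree (coeff P y). coeff (coeff P y) x * z ^ x * w ^ y)"
    by (simp add: eval2_def poly_altdef[of P] poly_sum poly_power sum_distrib_right)
       (simp add: poly_altdef sum_distrib_right)
  also have "\<dots> = (\<Sum>(x, y)\<in>B. coeff (coeff P y) x * z ^ x * w ^ y)"
    unfolding B_def by (subst sum.reindex) (auto simp: inj_on_def sum.Sigma case_prod_unfold)
  finally show ?thesis
    unfolding dps_sums_def
  proof (intro has_sum_finite_neutralI[of B])
    fix u assume u: "u \<in> UNIV - B"
    obtain x y where xy: "u = (x, y)"
      by force
    have "coeff (coeff P y) x = 0"
    proof (rule ccontr)
      assume nz: "coeff (coeff P y) x \<noteq> 0"
      then have "y \<le> degree P" "x \<le> degree (coeff P y)"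
        by (auto intro!: le_degree)
      with u show False
        by (auto simp: B_def xy)
    qed
    then show "(case u of (x, y) \<Rightarrow> coeff (coeff P y) x * z ^ x * w ^ y) = 0"
      by (simp add: xy)
  qed (auto simp: B_def)
qed

definition line_coeff :: "real \<Rightarrow> real \<Rightarrow> nat \<Rightarrow> nat \<Rightarrow> real" where
  "line_coeff \<alpha> \<beta> x y = real (x + y choose x) * \<alpha> ^ x * \<beta> ^ y"

text \<open>The geometric series in A + B is expanded by the binomial theorem. The hypothesis makes
  the same expansion for the norms converge, which is the absolute convergence needed to pass from
  degrees to pairs of exponents.\<close>

lemma dps_sums_line:
  assumes "\<alpha> > 0" "\<beta> > 0" and less: "\<alpha> * norm z + \<beta> * norm w < 1"
  shows "dps_sums (\<lambda>x y. of_real (line_coeff \<alpha> \<beta> x y)) z w (1 / (1 - of_real \<alpha> * z - of_real \<beta> * w))"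
proof -
  define A B where "A = of_real \<alpha> * z" and "B = of_real \<beta> * w"
  have nAB: "norm A + norm B < 1"
    using assms by (simp add: A_def B_def norm_mult)
  let ?g = "\<lambda>(n, x). of_nat (n choose x) * A ^ x * B ^ (n - x)"
  have "(\<lambda>(n, x). norm (?g (n, x))) summable_on (SIGMA n:UNIV. {..n})"
  proof (rule summable_on_SigmaI)
    show "((\<lambda>x. case (n, x) of (n, x) \<Rightarrow> norm (?g (n, x))) has_sum (norm A + norm B) ^ n) {..n}" for n
      by (rule has_sum_finiteI) (auto simp: binomial_ring norm_mult norm_power)
    show "(\<lambda>n. (norm A + norm B) ^ n) summable_on UNIV"
      using nAB by (subst summable_on_UNIV_nonneg_real_iff) (auto intro!: summable_geometric)
  qed auto
  then have "(\<lambda>u. norm (?g u)) summable_on (SIGMA n:UNIV. {..n})"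
    by (simp add: case_prod_unfold)
  then have sm: "?g summable_on (SIGMA n:UNIV. {..n})"
    using abs_summable_summable by blast
  have "norm (A + B) < 1"
    using norm_triangle_ineq[of A B] nAB by linarith
  then have "((\<lambda>n. (A + B) ^ n) has_sum 1 / (1 - (A + B))) UNIV"
    by (intro norm_summable_imp_has_sum geometric_sums)
       (auto simp: norm_power intro!: summable_geometric)
  then have "(?g has_sum 1 / (1 - (A + B))) (SIGMA n:UNIV. {..n})"
    by (rule has_sum_SigmaI[rotated, OF _ sm])
       (auto simp: binomial_ring intro!: has_sum_finiteI)
  also have "?this \<longleftrightarrow> ((\<lambda>(x, y). of_real (line_coeff \<alpha> \<beta> x y) * z ^ x * w ^ y) has_sum 1 / (1 - (A + B))) UNIV"
    by (rule has_sum_reindex_bij_witness[where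
          i = "\<lambda>(x, y). (x + y, x)" and j = "\<lambda>(n, x). (x, n - x)"])
       (auto simp: line_coeff_def A_def B_def power_mult_distrib)
  finally show ?thesis
    by (simp add: dps_sums_def A_def B_def diff_diff_eq)
qed

text \<open>One family \<open>h\<close> has to serve all points, hence the outer existential. The
  domain is explicit because convergence is needed at points far from the origin, namely slightly
  beyond the boundary point under study.\<close>

lemma dps_sums_quotient_exists:
  assumes "finite L" "\<And>l. l \<in> L \<Longrightarrow> a l > 0 \<and> b l > 0"
  shows "\<exists>h. \<forall>z w. (\<forall>l\<in>L. a l * norm z + b l * norm w < 1) \<longrightarrow>
           dps_sums h z w (eval2 P z w / (\<Prod>l\<in>L. 1 - of_real (a l) * z - of_real (b l) * w))"
  using assms
proof (induction L rule: finite_induct)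
  case empty
  then show ?case
    using dps_sums_poly by auto
next
  case (insert l L)
  then obtain h where h: "\<And>z w. (\<forall>l\<in>L. a l * norm z + b l * norm w < 1) \<Longrightarrow>
      dps_sums h z w (eval2 P z w / (\<Prod>l\<in>L. 1 - of_real (a l) * z - of_real (b l) * w))"
    by auto
  show ?case
  proof (intro exI allI impI)
    fix z w :: complex
    assume *: "\<forall>l\<in>insert l L. a l * norm z + b l * norm w < 1"
    have "dps_sums (conv (\<lambda>x y. of_real (line_coeff (a l) (b l) x y)) h) z w
       (1 / (1 - of_real (a l) * z - of_real (b l) * w) *
        (eval2 P z w / (\<Prod>l\<in>L. 1 - of_real (a l) * z - of_real (b l) * w)))"
      using * insert.prems by (intro dps_sums_conv h dps_sums_line) auto
    then show "dps_sums (conv (\<lambda>x y. of_real (line_coeff (a l) (b l) x y)) h) z w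
       (eval2 P z w / (\<Prod>l\<in>insert l L. 1 - of_real (a l) * z - of_real (b l) * w))"
      using insert.hyps by simp
  qed
qed

section \<open>Dominated convergence and the binomial kernel\<close>

text \<open>Tannery's theorem for series, transported along the enumeration
  \<open>prod_decode\<close> of pairs.\<close>

lemma tannery_infsum:
  fixes c :: "nat \<Rightarrow> nat \<times> nat \<Rightarrow> complex"
  assumes u: "u summable_on UNIV"
    and bound: "\<forall>\<^sub>F k in sequentially. \<forall>i. norm (c k i) \<le> u i"
    and lim: "\<And>i. (\<lambda>k. c k i) \<longlonglongrightarrow> L i"
  shows "(\<lambda>k. infsum (c k) UNIV) \<longlonglongrightarrow> infsum L UNIV"
proof -
  have infsum_eq: "infsum g UNIV = suminf (\<lambda>n. g (prod_decode n))"
    if "\<And>i. norm (g i) \<le> u i" for g :: "nat \<times> nat \<Rightarrow> complex"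
  proof -
    have "g summable_on UNIV"
      using Infinite_Sum.abs_summable_on_comparison_test'[OF u, of g] that abs_summable_summable by blast
    then have "(g has_sum infsum g UNIV) UNIV"
      by simp
    then have "((\<lambda>n. g (prod_decode n)) has_sum infsum g UNIV) UNIV"
      using has_sum_reindex_bij_betw[OF bij_prod_decode] by blast
    then show ?thesis
      using has_sum_imp_sums sums_unique by blast
  qed
  have "(\<lambda>n. u (prod_decode n)) summable_on UNIV"
    using u summable_on_reindex_bij_betw[OF bij_prod_decode] by blast
  then have su: "summable (\<lambda>n. u (prod_decode n))"
    by (rule summable_on_imp_summable)
  have "(\<lambda>k. suminf (\<lambda>n. c k (prod_decode n))) \<longlonglongrightarrow> suminf (\<lambda>n. L (prod_decode n))"
  proof (rule tannerys_theorem[THEN conjunct2, THEN conjunct2])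
    have "\<forall>\<^sub>F (n, k) in sequentially \<times>\<^sub>F sequentially. \<forall>i. norm (c k i) \<le> u i"
      using bound by (simp add: eventually_prod2)
    then show "\<forall>\<^sub>F (n, k) in sequentially \<times>\<^sub>F sequentially. norm (c k (prod_decode n)) \<le> u (prod_decode n)"
      by (rule eventually_mono) (simp only: case_prod_unfold)
  qed (use lim su in auto)
  \<comment> \<open>The limit family inherits the domination, so its unordered sum can be written as
    a series too.\<close>
  moreover have "norm (L i) \<le> u i" for i
  proof (rule tendsto_upperbound[OF tendsto_norm[OF lim[of i]]])
    show "\<forall>\<^sub>F k in sequentially. norm (c k i) \<le> u i"
      using bound by (rule eventually_mono) blast
  qed auto
  moreover have "\<forall>\<^sub>F k in sequentially. infsum (c k) UNIV = suminf (\<lambda>n. c k (prod_decode n))"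
    using bound by eventually_elim (auto intro: infsum_eq)
  ultimately show ?thesis
    using infsum_eq[of L] by (simp add: tendsto_cong)
qed

text \<open>Multiplied by \<open>z ^ X k * w ^ Y k\<close>, the convolution is the sum over (s, t)
  of the rescaled kernel at (X - s, Y - t) times the term of \<open>h\<close> at (z, w). The kernel
  may grow like \<rho> ^ (s + t), since this factor is absorbed by evaluating \<open>h\<close> at
  the dilated point. \<open>N\<close> is the normalisation under which the kernel converges.\<close>

lemma conv_tendsto:
  fixes g h :: "nat \<Rightarrow> nat \<Rightarrow> complex" and N :: "nat \<Rightarrow> complex"
  assumes X: "filterlim X at_top sequentially" and Y: "filterlim Y at_top sequentially"
    and bound: "\<forall>\<^sub>F k in sequentially. \<forall>s t. s \<le> X k \<longrightarrow> t \<le> Y k \<longrightarrow>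
        norm (N k * (g (X k - s) (Y k - t) * z ^ (X k - s) * w ^ (Y k - t))) \<le> C * \<rho> ^ (s + t)"
    and lim: "\<And>s t. (\<lambda>k. N k * (g (X k - s) (Y k - t) * z ^ (X k - s) * w ^ (Y k - t))) \<longlonglongrightarrow> c"
    and h: "dps_sums h z w S" and h\<rho>: "dps_sums h (of_real \<rho> * z) (of_real \<rho> * w) S'"
    and "\<rho> > 0" "C \<ge> 0"
  shows "(\<lambda>k. N k * (conv g h (X k) (Y k) * z ^ X k * w ^ Y k)) \<longlonglongrightarrow> c * S"
proof -
  define e where "e = (\<lambda>(s, t). h s t * z ^ s * w ^ t)"
  define A where "A k = (\<lambda>(s, t). N k * (g (X k - s) (Y k - t) * z ^ (X k - s) * w ^ (Y k - t)))" for k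
  \<comment> \<open>Extension by zero outside the rectangle turns the finite convolution into a sum
    over a fixed index set.\<close>
  define T where "T k = (\<lambda>i. if fst i \<le> X k \<and> snd i \<le> Y k then A k i * e i else 0)" for k
  define u where "u = (\<lambda>(s, t). C * norm (h s t * (of_real \<rho> * z) ^ s * (of_real \<rho> * w) ^ t))"
  have "(\<lambda>k. infsum (T k) UNIV) \<longlonglongrightarrow> infsum (\<lambda>i. c * e i) UNIV"
  proof (rule tannery_infsum)
    have "(\<lambda>(s, t). h s t * (of_real \<rho> * z) ^ s * (of_real \<rho> * w) ^ t) summable_on UNIV"
      using h\<rho> has_sum_imp_summable by (auto simp: dps_sums_def)
    then have "(\<lambda>u. norm (case u of (s, t) \<Rightarrow> h s t * (of_real \<rho> * z) ^ s * (of_real \<rho> * w) ^ t)) summable_on UNIV"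
      by (simp add: summable_on_iff_abs_summable_on_complex)
    from summable_on_cmult_right[OF this, of C] show "u summable_on UNIV"
      by (simp add: u_def case_prod_unfold)
    show "\<forall>\<^sub>F k in sequentially. \<forall>i. norm (T k i) \<le> u i"
      using bound
    proof eventually_elim
      case (elim k)
      show ?case
      proof
        fix i :: "nat \<times> nat"
        obtain s t where i: "i = (s, t)"
          by force
        show "norm (T k i) \<le> u i"
        proof (cases "s \<le> X k \<and> t \<le> Y k")
          case True
          then have "norm (A k i) \<le> C * \<rho> ^ (s + t)"
            using elim by (simp add: A_def i)
          then have "norm (A k i) * norm (e i) \<le> C * \<rho> ^ (s + t) * norm (e i)"
            by (rule mult_right_mono) auto
          then show ?thesis
            using True \<open>\<rho> > 0\<close>
            by (simp add: T_def i e_def u_def norm_mult norm_power power_add power_mult_distrib mult_ac)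
        next
          case False
          then show ?thesis
            using \<open>C \<ge> 0\<close> by (auto simp: T_def i u_def)
        qed
      qed
    qed
    show "(\<lambda>k. T k i) \<longlonglongrightarrow> c * e i" for i
    proof -
      obtain s t where i: "i = (s, t)"
        by force
      have "(\<lambda>k. A k i * e i) \<longlonglongrightarrow> c * e i"
        using lim[of s t] by (intro tendsto_mult_right) (simp add: A_def i)
      moreover have "\<forall>\<^sub>F k in sequentially. T k i = A k i * e i"
        using eventually_compose_filterlim[OF eventually_ge_at_top X, of s]
          eventually_compose_filterlim[OF eventually_ge_at_top Y, of t]
        by eventually_elim (simp add: T_def i)
      ultimately show ?thesis
        by (simp add: tendsto_cong)
    qed
  qed
  moreover have "infsum (\<lambda>i. c * e i) UNIV = c * S"
    using h by (intro infsumI has_sum_cmult_right) (simp add: dps_sums_def e_def)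
  moreover have "infsum (T k) UNIV = N k * (conv g h (X k) (Y k) * z ^ X k * w ^ Y k)" for k
  proof -
    have "infsum (T k) UNIV = sum (T k) ({..X k} \<times> {..Y k})"
      by (intro infsumI has_sum_finite_neutralI[of "{..X k} \<times> {..Y k}"]) (auto simp: T_def)
    also have "\<dots> = (\<Sum>(s, t)\<in>{..X k} \<times> {..Y k}. N k * (g (X k - s) (Y k - t) * h s t * z ^ X k * w ^ Y k))"
    proof (rule sum.cong[OF refl], clarsimp)
      fix s t
      assume st: "s \<le> X k" "t \<le> Y k"
      then have "z ^ X k = z ^ (X k - s) * z ^ s" "w ^ Y k = w ^ (Y k - t) * w ^ t"
        by (simp_all flip: power_add)
      then show "T k (s, t) = N k * (g (X k - s) (Y k - t) * h s t * z ^ X k * w ^ Y k)"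
        using st by (simp add: T_def A_def e_def)
    qed
    also have "\<dots> = N k * (conv g h (X k) (Y k) * z ^ X k * w ^ Y k)"
      by (simp add: conv_def case_prod_unfold sum_distrib_left sum_distrib_right mult_ac)
    finally show ?thesis .
  qed
  ultimately show ?thesis
    by simp
qed

section \<open>The binomial kernel along a ray\<close>

abbreviation bin_coeff :: "real \<Rightarrow> nat \<Rightarrow> nat \<Rightarrow> real" where
  "bin_coeff \<theta> \<equiv> line_coeff \<theta> (1 - \<theta>)"

lemma line_coeff_scale: "line_coeff (\<alpha> * z) (\<beta> * w) x y = line_coeff \<alpha> \<beta> x y * z ^ x * w ^ y"
  by (simp add: line_coeff_def power_mult_distrib)

text \<open>Identifies the rescaled kernel as the probability of x successes in x + y trials, which
  gives access to the total mass and the moments of the Bernstein polynomials.\<close>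

lemma bin_coeff_Bernstein: "bin_coeff \<theta> x y = Bernstein (x + y) x \<theta>"
  by (simp add: line_coeff_def Bernstein_def)

lemma bin_coeff_le_1:
  assumes "0 \<le> \<theta>" "\<theta> \<le> 1"
  shows "bin_coeff \<theta> x y \<le> 1"
  unfolding bin_coeff_Bernstein
  using member_le_sum[of x "{..x + y}" "\<lambda>k. Bernstein (x + y) k \<theta>"] assms
  by (simp add: Bernstein_nonneg)

lemma bin_coeff_pos: "0 < \<theta> \<Longrightarrow> \<theta> < 1 \<Longrightarrow> bin_coeff \<theta> x y > 0"
  by (simp add: line_coeff_def)

text \<open>Stirling's formula with an unidentified constant. The increments are O(1 / n^2), so the
  difference converges by telescoping.\<close>

lemma ln_fact_asymp: "\<exists>\<sigma>. (\<lambda>n. ln (fact n) - ((real n + 1 / 2) * ln (real n) - real n)) \<longlonglongrightarrow> \<sigma>"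
proof -
  define s where "s n = ln (fact n) - ((real n + 1 / 2) * ln (real n) - real n)" for n :: nat
  have "(\<lambda>n::nat. 1 - (real n + 1 / 2) * ln (1 + 1 / real n)) \<in> O(\<lambda>n. 1 / real n ^ 2)"
    by real_asymp
  then have "summable (\<lambda>n::nat. 1 - (real n + 1 / 2) * ln (1 + 1 / real n))"
    by (rule summable_comparison_test_bigo[rotated])
       (use inverse_power_summable[of 2, where 'a = real] in \<open>simp add: field_simps\<close>)
  moreover have "\<forall>\<^sub>F n in sequentially. s (Suc n) - s n = 1 - (real n + 1 / 2) * ln (1 + 1 / real n)"
    using eventually_gt_at_top[of 0]
  proof eventually_elim
    case (elim n)
    then have "1 + 1 / real n = real (Suc n) / real n"
      by (simp add: field_simps)
    then have 1: "ln (1 + 1 / real n) = ln (real (Suc n)) - ln (real n)"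
      using elim by (simp add: ln_div)
    have 2: "ln (fact (Suc n) :: real) = ln (real (Suc n)) + ln (fact n)"
      by (simp only: fact_Suc of_nat_mult ln_mult_pos of_nat_0_less_iff zero_less_Suc fact_gt_zero)
    have 3: "real (Suc n) = real n + 1"
      by simp
    show ?case
      unfolding s_def 1 2 by (simp only: 3) (simp add: field_simps)
  qed
  ultimately have "summable (\<lambda>n. s (Suc n) - s n)"
    using summable_cong by fast
  then have "convergent (\<lambda>n. \<Sum>i<n. s (Suc i) - s i)"
    by (simp add: summable_iff_convergent)
  then have "convergent (\<lambda>n. s n - s 0)"
    by (simp add: sum_lessThan_telescope)
  then obtain l where "(\<lambda>n. s n - s 0) \<longlonglongrightarrow> l"
    by (auto simp: convergent_def)
  from tendsto_add[OF this tendsto_const[of "s 0"]] show ?thesis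
    by (auto simp: s_def)
qed

text \<open>At \<theta> = p / (p + q) the main terms of Stirling's formula cancel exactly. What
  remains are the three halves of logarithms, that is -(ln k) / 2 and the constant \<open>c\<close>
  of the proof.\<close>

lemma bin_coeff_ray_asymp:
  fixes p q :: nat
  assumes "p > 0" "q > 0"
  defines "\<theta> \<equiv> real p / real (p + q)"
  obtains c where "c > 0" "(\<lambda>k. bin_coeff \<theta> (k * p) (k * q) * sqrt (real k)) \<longlonglongrightarrow> c"
proof -
  define s where "s n = ln (fact n) - ((real n + 1 / 2) * ln (real n) - real n)" for n :: nat
  obtain \<sigma> where \<sigma>: "s \<longlonglongrightarrow> \<sigma>"
    using ln_fact_asymp unfolding s_def by auto
  have s_mult: "(\<lambda>k. s (k * n)) \<longlonglongrightarrow> \<sigma>" if "n > 0" for n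
    using filterlim_compose[OF \<sigma> mult_nat_right_at_top[OF that]] .
  define c where "c = (ln (real (p + q)) - ln (real p) - ln (real q)) / 2"
  have \<theta>: "0 < \<theta>" "\<theta> < 1" "ln \<theta> = ln (real p) - ln (real (p + q))"
     "ln (1 - \<theta>) = ln (real q) - ln (real (p + q))"
  proof -
    have *: "1 - \<theta> = real q / real (p + q)"
      using assms by (simp add: \<theta>_def field_simps)
    show "0 < \<theta>" "\<theta> < 1" "ln \<theta> = ln (real p) - ln (real (p + q))"
     "ln (1 - \<theta>) = ln (real q) - ln (real (p + q))"
      unfolding * using assms by (auto simp: \<theta>_def ln_div)
  qed
  have "(\<lambda>k. exp (s (k * (p + q)) - s (k * p) - s (k * q) + c)) \<longlonglongrightarrow> exp (\<sigma> - \<sigma> - \<sigma> + c)"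
    using assms by (intro tendsto_intros s_mult) auto
  moreover have "\<forall>\<^sub>F k in sequentially. exp (s (k * (p + q)) - s (k * p) - s (k * q) + c) =
      bin_coeff \<theta> (k * p) (k * q) * sqrt (real k)"
    using eventually_gt_at_top[of 0]
  proof eventually_elim
    case (elim k)
    have pos: "bin_coeff \<theta> (k * p) (k * q) * sqrt (real k) > 0"
      using bin_coeff_pos[OF \<theta>(1,2)] elim by simp
    have bin: "bin_coeff \<theta> (k * p) (k * q) = fact (k * p + k * q) / (fact (k * p) * fact (k * q)) *
        (\<theta> ^ (k * p) * (1 - \<theta>) ^ (k * q))"
      by (simp add: line_coeff_def binomial_fact)
    have "ln (bin_coeff \<theta> (k * p) (k * q) * sqrt (real k)) =
        ln (bin_coeff \<theta> (k * p) (k * q)) + ln (real k) / 2"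
      using bin_coeff_pos[OF \<theta>(1,2)] elim by (subst ln_mult_pos) (auto simp: ln_sqrt)
    also have "ln (bin_coeff \<theta> (k * p) (k * q)) = ln (fact (k * p + k * q) / (fact (k * p) * fact (k * q))) +
        (ln (\<theta> ^ (k * p)) + ln ((1 - \<theta>) ^ (k * q)))"
      unfolding bin using \<theta>(1,2) by (subst ln_mult_pos, simp, simp, subst ln_mult_pos) auto
    also have "ln (fact (k * p + k * q) / (fact (k * p) * fact (k * q)) :: real) =
        ln (fact (k * p + k * q)) - (ln (fact (k * p)) + ln (fact (k * q)))"
      by (subst ln_divide_pos, simp, simp, subst ln_mult_pos) auto
    also have "ln (\<theta> ^ (k * p)) = real (k * p) * ln \<theta>"
      by (rule ln_realpow)
    also have "ln ((1 - \<theta>) ^ (k * q)) = real (k * q) * ln (1 - \<theta>)"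
      by (rule ln_realpow)
    also have "ln (fact (k * p + k * q)) - (ln (fact (k * p)) + ln (fact (k * q))) +
        (real (k * p) * ln \<theta> + real (k * q) * ln (1 - \<theta>)) + ln (real k) / 2 =
        s (k * (p + q)) - s (k * p) - s (k * q) + c"
    proof -
      have ln_k: "ln (real (k * n)) = ln (real k) + ln (real n)" if "n > 0" for n
        using elim that by (simp add: ln_mult)
      \<comment> \<open>The cancellation stated for arbitrary reals, so that it is a plain ring
        identity in which the logarithms are atoms.\<close>
      have ring: "F - (A + B) + (x * P * (lp - N) + x * Q * (lq - N)) + h * K =
          (F - ((x * P + x * Q + h) * (K + N) - (x * P + x * Q))) - (A - ((x * P + h) * (K + lp) - x * P)) -
          (B - ((x * Q + h) * (K + lq) - x * Q)) + h * (N - lp - lq)"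
        for F A B x P Q lp lq N h K :: real
        by (simp add: algebra_simps)
      have "s (k * (p + q)) = ln (fact (k * p + k * q)) -
          ((real k * real p + real k * real q + 1 / 2) * (ln (real k) + ln (real (p + q))) -
           (real k * real p + real k * real q))"
        using assms(1) by (simp only: s_def ln_k) (simp add: distrib_left)
      moreover have "s (k * p) = ln (fact (k * p)) -
          ((real k * real p + 1 / 2) * (ln (real k) + ln (real p)) - real k * real p)"
        using assms(1) by (simp only: s_def ln_k) simp
      moreover have "s (k * q) = ln (fact (k * q)) -
          ((real k * real q + 1 / 2) * (ln (real k) + ln (real q)) - real k * real q)"
        using assms(2) by (simp only: s_def ln_k) simp
      moreover have "c = 1 / 2 * (ln (real (p + q)) - ln (real p) - ln (real q))"
        by (simp add: c_def)
      ultimately show ?thesis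
        using ring[of "ln (fact (k * p + k * q))" "ln (fact (k * p))" "ln (fact (k * q))" "real k"
            "real p" "ln (real p)" "ln (real (p + q))" "real q" "ln (real q)" "1 / 2" "ln (real k)"]
        unfolding \<theta>(3,4) by (simp only: of_nat_mult mult_1 times_divide_eq_left)
    qed
    finally have eq: "ln (bin_coeff \<theta> (k * p) (k * q) * sqrt (real k)) =
        s (k * (p + q)) - s (k * p) - s (k * q) + c" .
    show ?case
      using exp_ln[OF pos] unfolding eq .
  qed
  ultimately have "(\<lambda>k. bin_coeff \<theta> (k * p) (k * q) * sqrt (real k)) \<longlonglongrightarrow> exp (\<sigma> - \<sigma> - \<sigma> + c)"
    by (rule Lim_transform_eventually)
  then show ?thesis
    by (rule that[OF exp_gt_zero])
qed

lemma line_coeff_swap: "line_coeff \<alpha> \<beta> x y = line_coeff \<beta> \<alpha> y x"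
  using binomial_symmetric[of x "x + y"] by (simp add: line_coeff_def add.commute mult_ac)

lemma bin_coeff_Suc_left:
  "bin_coeff \<theta> x y * (\<theta> * real (Suc x + y)) = bin_coeff \<theta> (Suc x) y * real (Suc x)"
proof -
  have "real (Suc (x + y)) * real (x + y choose x) = real (Suc (x + y) choose Suc x) * real (Suc x)"
    unfolding of_nat_mult[symmetric] by (subst Suc_times_binomial_eq) (rule refl)
  then show ?thesis
    by (simp add: line_coeff_def mult_ac del: binomial_Suc_Suc of_nat_Suc)
qed

lemma bin_coeff_Suc_right:
  "bin_coeff \<theta> x y * ((1 - \<theta>) * real (x + Suc y)) = bin_coeff \<theta> x (Suc y) * real (Suc y)"
  using bin_coeff_Suc_left[of "1 - \<theta>" y x]
  by (simp add: line_coeff_swap[of "1 - \<theta>" "\<theta>"] add.commute)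

text \<open>Separates the effect of a shift from the size of the unshifted kernel, which carries the
  factor 1 / sqrt k.\<close>

definition bin_ratio :: "real \<Rightarrow> nat \<Rightarrow> nat \<Rightarrow> nat \<Rightarrow> nat \<Rightarrow> real" where
  "bin_ratio \<theta> X Y s t = bin_coeff \<theta> (X - s) (Y - t) / bin_coeff \<theta> X Y"

lemma bin_ratio_Suc_left:
  assumes "0 < \<theta>" "\<theta> < 1" "s < X" "t \<le> Y"
  shows "bin_ratio \<theta> X Y (Suc s) t =
    bin_ratio \<theta> X Y s t * (real (X - s) / (\<theta> * real (X - s + (Y - t))))"
proof -
  obtain x y where xy: "X - s = Suc x" "X - Suc s = x" "Y - t = y"
    using assms(3) by (cases "X - s") auto
  have "\<theta> * real (Suc x + y) \<noteq> 0"
    using assms by simp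
  then have "bin_coeff \<theta> x y = bin_coeff \<theta> (Suc x) y * (real (Suc x) / (\<theta> * real (Suc x + y)))"
    using bin_coeff_Suc_left[of \<theta> x y] by (simp only: times_divide_eq_right eq_divide_eq if_True not_False_eq_True)
  then show ?thesis
    by (simp only: bin_ratio_def xy times_divide_eq_left)
qed

lemma bin_ratio_Suc_right:
  assumes "0 < \<theta>" "\<theta> < 1" "s \<le> X" "t < Y"
  shows "bin_ratio \<theta> X Y s (Suc t) =
    bin_ratio \<theta> X Y s t * (real (Y - t) / ((1 - \<theta>) * real (X - s + (Y - t))))"
proof -
  obtain x y where xy: "Y - t = Suc y" "Y - Suc t = y" "X - s = x"
    using assms(4) by (cases "Y - t") auto
  have "(1 - \<theta>) * real (x + Suc y) \<noteq> 0"
    using assms by simp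
  then have "bin_coeff \<theta> x y = bin_coeff \<theta> x (Suc y) * (real (Suc y) / ((1 - \<theta>) * real (x + Suc y)))"
    using bin_coeff_Suc_right[of \<theta> x y] by (simp only: times_divide_eq_right eq_divide_eq if_True not_False_eq_True)
  then show ?thesis
    by (simp only: bin_ratio_def xy times_divide_eq_left)
qed

lemma ray_quotient_limit:
  fixes p n d e :: nat
  assumes "n > 0" "c * real n = real p" "c > 0"
  shows "(\<lambda>k. real (k * p - d) / (c * real (k * n - e))) \<longlonglongrightarrow> 1"
proof -
  have "real p > 0"
    using assms by (metis mult_pos_pos of_nat_0_less_iff)
  then have p: "p > 0"
    by simp
  have lim: "(\<lambda>k. (real p - real d / real k) / (c * (real n - real e / real k))) \<longlonglongrightarrow>
      (real p - 0) / (c * (real n - 0))"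
    using assms p by (intro tendsto_intros lim_const_over_n) auto
  have one: "(real p - 0) / (c * (real n - 0)) = 1"
    using assms p by simp
  have "\<forall>\<^sub>F k in sequentially. (real p - real d / real k) / (c * (real n - real e / real k)) =
      real (k * p - d) / (c * real (k * n - e))"
    using eventually_gt_at_top[of "d + e"]
  proof eventually_elim
    case (elim k)
    have "k * 1 \<le> k * p" "k * 1 \<le> k * n"
      using p assms(1) by (auto simp del: mult_1_right intro!: mult_le_mono2)
    with elim have "d \<le> k * p" "e \<le> k * n"
      by linarith+
    moreover have "real k * (u - v / real k) = real k * u - v" for u v :: real
      using elim by (simp add: right_diff_distrib)
    ultimately have "real (k * p - d) = real k * (real p - real d / real k)"
      "real (k * n - e) = real k * (real n - real e / real k)"
      by (simp_all only: of_nat_diff of_nat_mult)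
    then show ?case
      using elim by simp
  qed
  then have "(\<lambda>k. real (k * p - d) / (c * real (k * n - e))) \<longlonglongrightarrow> (real p - 0) / (c * (real n - 0))"
    by (rule Lim_transform_eventually[OF lim])
  then show ?thesis
    unfolding one .
qed

text \<open>A unit shift multiplies the ratio by x / (\<theta> (x + y)) or y / ((1 - \<theta>) (x +
  y)), and both tend to 1 on the ray because \<theta> is its slope p / (p + q). A fixed shift
  consists of finitely many unit shifts.\<close>

lemma bin_ratio_limit:
  fixes p q :: nat
  assumes "p > 0" "q > 0"
  defines "\<theta> \<equiv> real p / real (p + q)"
  shows "(\<lambda>k. bin_ratio \<theta> (k * p) (k * q) s t) \<longlonglongrightarrow> 1"
proof -
  have \<theta>: "0 < \<theta>" "\<theta> < 1" "\<theta> * real (p + q) = real p" "(1 - \<theta>) * real (p + q) = real q"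
    using assms by (auto simp: \<theta>_def field_simps)
  have big: "\<forall>\<^sub>F k in sequentially. s < k * p \<and> t < k * q" for s t
    using eventually_gt_at_top[of "s + t"]
  proof eventually_elim
    case (elim k)
    have "k * 1 \<le> k * p" "k * 1 \<le> k * q"
      using assms by (auto simp del: mult_1_right intro!: mult_le_mono2)
    with elim show ?case by linarith
  qed
  have left: "(\<lambda>k. bin_ratio \<theta> (k * p) (k * q) s 0) \<longlonglongrightarrow> 1" for s
  proof (induction s)
    case 0
    have "bin_ratio \<theta> x y 0 0 = 1" for x y
      using bin_coeff_pos[OF \<theta>(1,2), of x y] by (simp add: bin_ratio_def)
    then show ?case
      by simp
  next
    case (Suc s)
    have "(\<lambda>k. bin_ratio \<theta> (k * p) (k * q) s 0 *
        (real (k * p - s) / (\<theta> * real (k * (p + q) - s)))) \<longlonglongrightarrow> 1 * 1"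
      using assms \<theta> by (intro tendsto_mult Suc.IH ray_quotient_limit) auto
    moreover have "\<forall>\<^sub>F k in sequentially. bin_ratio \<theta> (k * p) (k * q) s 0 *
        (real (k * p - s) / (\<theta> * real (k * (p + q) - s))) = bin_ratio \<theta> (k * p) (k * q) (Suc s) 0"
      using big[of s 0]
    proof eventually_elim
      case (elim k)
      then have "k * (p + q) - s = k * p - s + (k * q - 0)"
        by (simp add: distrib_left)
      then show ?case
        using elim by (simp only: bin_ratio_Suc_left[OF \<theta>(1,2)])
    qed
    ultimately show ?case
      by (simp add: Lim_transform_eventually)
  qed
  show ?thesis
  proof (induction t)
    case 0
    show ?case by (rule left)
  next
    case (Suc t)
    have "(\<lambda>k. bin_ratio \<theta> (k * p) (k * q) s t *
        (real (k * q - t) / ((1 - \<theta>) * real (k * (p + q) - (s + t))))) \<longlonglongrightarrow> 1 * 1"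
      using assms \<theta> by (intro tendsto_mult Suc.IH ray_quotient_limit) auto
    moreover have "\<forall>\<^sub>F k in sequentially. bin_ratio \<theta> (k * p) (k * q) s t *
        (real (k * q - t) / ((1 - \<theta>) * real (k * (p + q) - (s + t)))) = bin_ratio \<theta> (k * p) (k * q) s (Suc t)"
      using big[of s t]
    proof eventually_elim
      case (elim k)
      then have "k * (p + q) - (s + t) = k * p - s + (k * q - t)"
        by (simp add: distrib_left)
      then show ?case
        using elim by (simp only: bin_ratio_Suc_right[OF \<theta>(1,2)] less_imp_le)
    qed
    ultimately show ?case
      by (simp add: Lim_transform_eventually)
  qed
qed

text \<open>With n = X + Y, the factor of one more unit shift after s + t of them is at most n / (n
  - s - t), and this is at most \<rho> precisely under the condition \<open>near\<close>.\<close>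

lemma bin_ratio_bound_near:
  assumes \<theta>: "0 < \<theta>" "\<theta> < 1" "\<theta> * real (X + Y) = real X"
    and \<rho>: "\<rho> > 1" and near: "\<rho> * real (s + t) \<le> (\<rho> - 1) * real (X + Y)"
    and "s \<le> X" "t \<le> Y"
  shows "bin_ratio \<theta> X Y s t \<le> \<rho> ^ (s + t)"
  using near \<open>s \<le> X\<close> \<open>t \<le> Y\<close>
proof (induction "s + t" arbitrary: s t)
  case 0
  then show ?case
    using bin_coeff_pos[OF \<theta>(1,2), of X Y] by (simp add: bin_ratio_def)
next
  case (Suc r)
  have \<theta>': "(1 - \<theta>) * real (X + Y) = real Y"
    using \<theta>(3) by (simp add: algebra_simps)
  have nonneg: "bin_ratio \<theta> X Y s t \<ge> 0" for s t
    using bin_coeff_pos[OF \<theta>(1,2)] by (simp add: bin_ratio_def less_imp_le)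
  \<comment> \<open>Covers both directions: c = \<theta> with Z = X, and c = 1 - \<theta> with Z =
    Y.\<close>
  have factor: "real (Z - u) / (c * real (X - s + (Y - t))) \<le> \<rho>"
    if c: "c > 0" "c * real (X + Y) = real Z" and st: "s \<le> X" "t \<le> Y" "Suc (s + t) \<le> X + Y"
      "\<rho> * real (s + t) \<le> (\<rho> - 1) * real (X + Y)" for c Z u s t
  proof -
    have m: "real (X - s + (Y - t)) = real (X + Y) - real (s + t)"
      using st by (simp add: of_nat_diff)
    have "real (Z - u) \<le> c * real (X + Y)"
      using c by simp
    also have "\<dots> \<le> c * (\<rho> * real (X - s + (Y - t)))"
      unfolding m using c st by (intro mult_left_mono) (auto simp: algebra_simps)
    finally have le: "real (Z - u) \<le> c * (\<rho> * real (X - s + (Y - t)))" .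
    have "real (X - s + (Y - t)) > 0"
      using st unfolding m by linarith
    then show ?thesis
      using c le by (subst pos_divide_le_eq) (auto simp only: mult_pos_pos mult_ac)
  qed
  have less: "\<rho> * real (s' + t') \<le> (\<rho> - 1) * real (X + Y)" if "s' + t' \<le> s + t" for s' t'
  proof -
    have "\<rho> * real (s' + t') \<le> \<rho> * real (s + t)"
      using \<rho> that by (intro mult_left_mono) auto
    with Suc.prems(1) show ?thesis by linarith
  qed
  show ?case
  proof (cases s)
    case (Suc s')
    have "bin_ratio \<theta> X Y s t = bin_ratio \<theta> X Y s' t * (real (X - s') / (\<theta> * real (X - s' + (Y - t))))"
      using Suc Suc.prems \<theta> by (simp add: bin_ratio_Suc_left)
    also have "\<dots> \<le> \<rho> ^ (s' + t) * \<rho>"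
    proof (intro mult_mono)
      show "bin_ratio \<theta> X Y s' t \<le> \<rho> ^ (s' + t)"
        using Suc Suc.hyps Suc.prems less by auto
      show "real (X - s') / (\<theta> * real (X - s' + (Y - t))) \<le> \<rho>"
        using Suc Suc.prems \<theta> less by (intro factor) auto
    qed (use \<rho> \<theta> in auto)
    finally show ?thesis
      using Suc by (simp add: mult_ac)
  next
    case 0
    then obtain t' where t': "t = Suc t'"
      using Suc.hyps by (cases t) auto
    have "bin_ratio \<theta> X Y s t = bin_ratio \<theta> X Y s t' * (real (Y - t') / ((1 - \<theta>) * real (X - s + (Y - t'))))"
      using t' Suc.prems \<theta> by (simp add: bin_ratio_Suc_right)
    also have "\<dots> \<le> \<rho> ^ (s + t') * \<rho>"
    proof (intro mult_mono)
      show "bin_ratio \<theta> X Y s t' \<le> \<rho> ^ (s + t')"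
        using t' Suc.hyps Suc.prems less by auto
      show "real (Y - t') / ((1 - \<theta>) * real (X - s + (Y - t'))) \<le> \<rho>"
        using t' Suc.prems \<theta> \<theta>' less by (intro factor) auto
    qed (use \<rho> \<theta> in auto)
    finally show ?thesis
      using t' by (simp add: mult_ac)
  qed
qed

text \<open>Beyond the range of the previous estimate, s + t is at least a fixed multiple of k.
  There the numerator is bounded by 1 and the denominator from below by a multiple of 1 / sqrt k,
  and the resulting sqrt k is absorbed by \<rho> ^ (s + t).\<close>

lemma bin_ratio_bound:
  fixes p q :: nat
  assumes pq: "p > 0" "q > 0" and \<rho>: "\<rho> > 1"
  defines "\<theta> \<equiv> real p / real (p + q)"
  obtains C where "C \<ge> 0" "\<forall>\<^sub>F k in sequentially. \<forall>s t. s \<le> k * p \<longrightarrow> t \<le> k * q \<longrightarrow>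
    bin_ratio \<theta> (k * p) (k * q) s t \<le> C * \<rho> ^ (s + t)"
proof -
  have \<theta>: "0 < \<theta>" "\<theta> < 1" "\<theta> * real (p + q) = real p"
    using assms by (auto simp: \<theta>_def field_simps)
  obtain c where c: "c > 0" "(\<lambda>k. bin_coeff \<theta> (k * p) (k * q) * sqrt (real k)) \<longlonglongrightarrow> c"
    using bin_coeff_ray_asymp[OF pq] unfolding \<theta>_def by blast
  \<comment> \<open>1 serves short shifts. For long ones, 2 / c comes from the lower bound c / 2 of
    the normalised kernel, \<rho> / (\<rho> - 1) from the failure of the nearness condition, and the
    last 1 / (\<rho> - 1) from Bernoulli's inequality.\<close>
  define C where "C = max 1 (2 / c * (\<rho> / (\<rho> - 1) / (\<rho> - 1)))"
  have "\<forall>\<^sub>F k in sequentially. bin_coeff \<theta> (k * p) (k * q) * sqrt (real k) > c / 2"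
    using c by (intro order_tendstoD) auto
  then have "\<forall>\<^sub>F k in sequentially. \<forall>s t. s \<le> k * p \<longrightarrow> t \<le> k * q \<longrightarrow>
    bin_ratio \<theta> (k * p) (k * q) s t \<le> C * \<rho> ^ (s + t)"
    using eventually_gt_at_top[of 0]
  proof eventually_elim
    case (elim k)
    show ?case
    proof (intro allI impI)
      fix s t
      assume st: "s \<le> k * p" "t \<le> k * q"
      let ?b = "bin_coeff \<theta> (k * p) (k * q)"
      show "bin_ratio \<theta> (k * p) (k * q) s t \<le> C * \<rho> ^ (s + t)"
      proof (cases "\<rho> * real (s + t) \<le> (\<rho> - 1) * real (k * p + k * q)")
        case True
        have "\<theta> * real (k * p + k * q) = real (k * p)"
          using arg_cong[OF \<theta>(3), of "\<lambda>u. real k * u"] by (simp add: algebra_simps)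
        then have "bin_ratio \<theta> (k * p) (k * q) s t \<le> \<rho> ^ (s + t)"
          using True st \<rho> \<theta> by (intro bin_ratio_bound_near)
        also have "\<dots> \<le> C * \<rho> ^ (s + t)"
          using \<rho> mult_right_mono[of 1 C "\<rho> ^ (s + t)"] by (simp add: C_def)
        finally show ?thesis .
      next
        case False
        have b: "?b > 0"
          using \<theta> by (intro bin_coeff_pos)
        have "bin_ratio \<theta> (k * p) (k * q) s t \<le> 1 / ?b"
          unfolding bin_ratio_def using b \<theta> by (intro divide_right_mono bin_coeff_le_1) auto
        also have "1 / ?b \<le> 2 / c * sqrt (real k)"
          using elim(1) b c(1) by (simp add: field_simps)
        also have "sqrt (real k) \<le> real k"
        proof -
          have "real k * 1 \<le> real k * real k"
            using elim(2) by (intro mult_left_mono) auto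
          then show ?thesis
            by (intro real_le_lsqrt) (auto simp: power2_eq_square)
        qed
        also have "real k \<le> real (k * p + k * q)"
          using pq by (cases p) auto
        also have "real (k * p + k * q) \<le> \<rho> / (\<rho> - 1) * real (s + t)"
          using False \<rho> by (simp add: field_simps)
        also have "real (s + t) \<le> \<rho> ^ (s + t) / (\<rho> - 1)"
        proof -
          have "1 + real (s + t) * (\<rho> - 1) \<le> (1 + (\<rho> - 1)) ^ (s + t)"
            using \<rho> by (intro Bernoulli_inequality) auto
          then show ?thesis
            using \<rho> by (simp add: field_simps)
        qed
        finally have "bin_ratio \<theta> (k * p) (k * q) s t \<le>
            2 / c * (\<rho> / (\<rho> - 1) * (\<rho> ^ (s + t) / (\<rho> - 1)))"
          using c(1) \<rho> by (simp add: mult_left_mono divide_right_mono)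
        also have "\<dots> = 2 / c * (\<rho> / (\<rho> - 1) / (\<rho> - 1)) * \<rho> ^ (s + t)"
          by simp
        also have "\<dots> \<le> C * \<rho> ^ (s + t)"
          using \<rho> by (intro mult_right_mono) (auto simp: C_def)
        finally show ?thesis .
      qed
    qed
  qed
  then show ?thesis
    using that[of C] by (simp add: C_def)
qed

section \<open>The kernel of two lines\<close>

lemma eventually_dps_sums_line:
  assumes "\<alpha> > 0" "\<beta> > 0"
  shows "\<forall>\<^sub>F (z, w) in nhds (0, 0). \<alpha> * norm (z :: complex) + \<beta> * norm (w :: complex) < 1"
proof -
  have "((\<lambda>u :: complex \<times> complex. \<alpha> * norm (fst u) + \<beta> * norm (snd u)) \<longlongrightarrow>
      \<alpha> * norm (fst (0 :: complex \<times> complex)) + \<beta> * norm (snd (0 :: complex \<times> complex))) (nhds (0, 0))"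
    by (intro tendsto_intros) (auto simp: filterlim_ident zero_prod_def)
  then have "\<forall>\<^sub>F u in nhds (0 :: complex, 0 :: complex). \<alpha> * norm (fst u) + \<beta> * norm (snd u) < 1"
    by (rule order_tendstoD) simp
  then show ?thesis
    by (simp add: case_prod_unfold)
qed

lemma line_factor_nonzero:
  assumes "\<alpha> > 0" "\<beta> > 0" "\<alpha> * norm z + \<beta> * norm w < 1"
  shows "1 - of_real \<alpha> * z - of_real \<beta> * (w :: complex) \<noteq> 0"
proof
  assume "1 - of_real \<alpha> * z - of_real \<beta> * w = 0"
  then have "of_real \<alpha> * z + of_real \<beta> * w = 1"
    by (simp add: algebra_simps)
  then have "1 \<le> norm (of_real \<alpha> * z) + norm (of_real \<beta> * w)"
    by (metis norm_one norm_triangle_ineq)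
  with assms show False
    by (simp add: norm_mult)
qed

lemma conv_of_real:
  "conv (\<lambda>x y. of_real (f x y)) (\<lambda>x y. of_real (g x y)) = (\<lambda>x y. complex_of_real (conv f g x y))"
  by (intro ext) (simp add: conv_def case_prod_unfold)

text \<open>The linear forms $1 - \alpha z - (1 - \alpha) w$ and $1 - \beta z - (1 - \beta) w$ differ by
  $(\alpha - \beta)(z - w)$, so the product of their inverses becomes a difference of the inverses
  after multiplication by $(\alpha - \beta)(z - w)$.\<close>

lemma conv_bin_coeff_step:
  assumes \<alpha>: "0 < \<alpha>" "\<alpha> < 1" and \<beta>: "0 < \<beta>" "\<beta> < 1"
  defines "H \<equiv> conv (bin_coeff \<alpha>) (bin_coeff \<beta>)"
  shows "(\<alpha> - \<beta>) * (H x y - (if y = 0 then 0 else H (Suc x) (y - 1))) =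
    bin_coeff \<alpha> (Suc x) y - bin_coeff \<beta> (Suc x) y"
proof -
  define d :: "nat \<Rightarrow> nat \<Rightarrow> real" where
    "d x y = (if x = 1 \<and> y = 0 then \<alpha> - \<beta> else if x = 0 \<and> y = 1 then \<beta> - \<alpha> else 0)" for x y
  have d: "dps_sums (\<lambda>x y. of_real (d x y)) z w (of_real (\<alpha> - \<beta>) * (z - w))" for z w
    unfolding dps_sums_def
    by (rule has_sum_finite_neutralI[of "{(1, 0), (0, 1)}"]) (auto simp: d_def algebra_simps split: if_splits)
  let ?q = "\<lambda>\<gamma> z w. 1 / (1 - of_real \<gamma> * z - of_real (1 - \<gamma>) * w) :: complex"
  have "(\<lambda>x y. complex_of_real (conv H d x y)) = (\<lambda>x y. of_real (bin_coeff \<alpha> x y - bin_coeff \<beta> x y))"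
  proof (rule dps_sums_unique[where F = "\<lambda>z w. ?q \<alpha> z w - ?q \<beta> z w"])
    have ev: "\<forall>\<^sub>F (z, w) in nhds (0, 0). \<gamma> * norm (z :: complex) + (1 - \<gamma>) * norm (w :: complex) < 1"
      if "0 < \<gamma>" "\<gamma> < 1" for \<gamma>
      using that by (intro eventually_dps_sums_line) auto
    show "\<forall>\<^sub>F (z, w) in nhds (0, 0). dps_sums (\<lambda>x y. of_real (bin_coeff \<alpha> x y - bin_coeff \<beta> x y)) z w
        (?q \<alpha> z w - ?q \<beta> z w)"
      using ev[OF \<alpha>] ev[OF \<beta>]
    proof eventually_elim
      case (elim u)
      obtain z w where u: "u = (z, w)"
        by force
      have "dps_sums (\<lambda>x y. of_real (bin_coeff \<alpha> x y)) z w (?q \<alpha> z w)"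
        "dps_sums (\<lambda>x y. of_real (bin_coeff \<beta> x y)) z w (?q \<beta> z w)"
        using elim \<alpha> \<beta> by (auto simp only: u prod.case intro!: dps_sums_line)
      from has_sum_add[OF this(1)[unfolded dps_sums_def] has_sum_uminusI[OF this(2)[unfolded dps_sums_def]]]
      show ?case
        by (simp add: u dps_sums_def case_prod_unfold algebra_simps)
    qed
    show "\<forall>\<^sub>F (z, w) in nhds (0, 0). dps_sums (\<lambda>x y. of_real (conv H d x y)) z w (?q \<alpha> z w - ?q \<beta> z w)"
      using ev[OF \<alpha>] ev[OF \<beta>]
    proof eventually_elim
      case (elim u)
      obtain z w where u: "u = (z, w)"
        by force
      have "dps_sums (\<lambda>x y. of_real (conv H d x y)) z w (?q \<alpha> z w * ?q \<beta> z w * (of_real (\<alpha> - \<beta>) * (z - w)))"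
        unfolding H_def conv_of_real[symmetric]
        using elim \<alpha> \<beta> by (intro dps_sums_conv d dps_sums_line) (auto simp: u)
      moreover have "?q \<alpha> z w * ?q \<beta> z w * (of_real (\<alpha> - \<beta>) * (z - w)) = ?q \<alpha> z w - ?q \<beta> z w"
      proof -
        have frac: "1 / A * (1 / B) * (B - A) = 1 / A - 1 / B" if "A \<noteq> 0" "B \<noteq> 0" for A B :: complex
          using that by (simp add: field_simps)
        have "1 - of_real \<alpha> * z - of_real (1 - \<alpha>) * w \<noteq> 0" "1 - of_real \<beta> * z - of_real (1 - \<beta>) * w \<noteq> 0"
          by (rule line_factor_nonzero; use elim \<alpha> \<beta> in \<open>simp add: u\<close>)+
        from frac[OF this] show ?thesis
          by (simp add: algebra_simps)
      qed
      ultimately show ?case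
        by (simp only: u prod.case)
    qed
  qed
  \<comment> \<open>At the exponent \<open>Suc x\<close> the factor z leads back to (x, y), while w
    leads to (x + 1, y - 1), which is absent for y = 0.\<close>
  from fun_cong[OF fun_cong[OF this, of "Suc x"], of y]
  have "conv H d (Suc x) y = bin_coeff \<alpha> (Suc x) y - bin_coeff \<beta> (Suc x) y"
    by (simp only: of_real_eq_iff)
  moreover have "conv H d (Suc x) y = (\<alpha> - \<beta>) * (H x y - (if y = 0 then 0 else H (Suc x) (y - 1)))"
  proof -
    have "conv H d (Suc x) y = (\<Sum>(s, t)\<in>(if y = 0 then {(1, 0)} else {(1, 0), (0, 1)}). H (Suc x - s) (y - t) * d s t)"
      unfolding conv_def by (rule sum.mono_neutral_right) (auto simp: d_def split: if_splits)
    then show ?thesis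
      by (simp add: d_def algebra_simps)
  qed
  ultimately show ?thesis
    by simp
qed

text \<open>The probability of more than x successes in x + y + 1 trials: the sum runs along the
  antidiagonal of degree x + y + 1 on which the recurrence above lives.\<close>

definition bin_tail :: "real \<Rightarrow> nat \<Rightarrow> nat \<Rightarrow> real" where
  "bin_tail \<theta> x y = (\<Sum>l\<le>y. bin_coeff \<theta> (Suc x + l) (y - l))"

text \<open>The recurrence links (x, y) to (x + 1, y - 1); followed down to y = 0 along one
  antidiagonal, its right-hand sides add up to the two tails. Hence the induction on y with x
  arbitrary.\<close>

lemma conv_bin_coeff:
  assumes "0 < \<alpha>" "\<alpha> < 1" "0 < \<beta>" "\<beta> < 1"
  shows "(\<alpha> - \<beta>) * conv (bin_coeff \<alpha>) (bin_coeff \<beta>) x y = bin_tail \<alpha> x y - bin_tail \<beta> x y"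
proof (induction y arbitrary: x)
  case 0
  then show ?case
    using conv_bin_coeff_step[OF assms, of x 0] by (simp add: bin_tail_def)
next
  case (Suc y)
  have "bin_tail \<gamma> x (Suc y) = bin_coeff \<gamma> (Suc x) (Suc y) + bin_tail \<gamma> (Suc x) y" for \<gamma>
    unfolding bin_tail_def by (subst sum.atMost_Suc_shift) simp
  then show ?case
    using conv_bin_coeff_step[OF assms, of x "Suc y"] Suc.IH[of "Suc x"] by (simp add: algebra_simps)
qed

lemma bin_tail_Bernstein:
  "bin_tail \<theta> x y = (\<Sum>j=Suc x..Suc (x + y). Bernstein (Suc (x + y)) j \<theta>)"
  unfolding bin_tail_def bin_coeff_Bernstein
  by (rule sum.reindex_bij_witness[of _ "\<lambda>j. j - Suc x" "\<lambda>l. Suc x + l"]) auto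

lemma bin_tail_range:
  assumes "0 \<le> \<theta>" "\<theta> \<le> 1"
  shows "0 \<le> bin_tail \<theta> x y" "bin_tail \<theta> x y \<le> 1"
proof -
  show "0 \<le> bin_tail \<theta> x y"
    unfolding bin_tail_Bernstein using assms by (intro sum_nonneg Bernstein_nonneg) auto
  have "bin_tail \<theta> x y \<le> (\<Sum>j\<le>Suc (x + y). Bernstein (Suc (x + y)) j \<theta>)"
    unfolding bin_tail_Bernstein using assms by (intro sum_mono2 Bernstein_nonneg) auto
  then show "bin_tail \<theta> x y \<le> 1"
    by simp
qed

lemma bin_tail_complement:
  "1 - bin_tail \<theta> x y = (\<Sum>j\<le>x. Bernstein (Suc (x + y)) j \<theta>)"
proof -
  have "{..Suc (x + y)} = {..x} \<union> {Suc x..Suc (x + y)}"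
    by auto
  then have "(\<Sum>j\<le>Suc (x + y). Bernstein (Suc (x + y)) j \<theta>) =
      (\<Sum>j\<le>x. Bernstein (Suc (x + y)) j \<theta>) + (\<Sum>j=Suc x..Suc (x + y). Bernstein (Suc (x + y)) j \<theta>)"
    by (simp only:) (subst sum.union_disjoint, auto)
  then show ?thesis
    by (simp add: bin_tail_Bernstein)
qed

lemma Bernstein_variance: "(\<Sum>k\<le>n. (real k - real n * x)\<^sup>2 * Bernstein n k x) = real n * x * (1 - x)"
proof -
  \<comment> \<open>Splits the square into a (a - 1), a and 1, whose Bernstein sums are
    known.\<close>
  have *: "(a - b)\<^sup>2 * x = a * (a - 1) * x + (1 - 2 * b) * (a * x) + b * b * x" for a b x :: real
    by (simp add: algebra_simps power2_eq_square)
  show ?thesis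
    by (simp only: * sum.distrib sum_kk_Bernstein sum_k_Bernstein sum_Bernstein flip: sum_distrib_left)
       (simp add: algebra_simps power2_eq_square)
qed

lemma Bernstein_Chebyshev:
  assumes \<theta>: "0 \<le> \<theta>" "\<theta> \<le> 1" and "\<delta> > 0" "n > 0" and J: "J \<subseteq> {..n}"
    and far: "\<And>j. j \<in> J \<Longrightarrow> \<bar>real j - real n * \<theta>\<bar> \<ge> \<delta> * real n"
  shows "(\<Sum>j\<in>J. Bernstein n j \<theta>) \<le> 1 / (\<delta>\<^sup>2 * real n)"
proof -
  have "(\<delta> * real n)\<^sup>2 * (\<Sum>j\<in>J. Bernstein n j \<theta>) = (\<Sum>j\<in>J. (\<delta> * real n)\<^sup>2 * Bernstein n j \<theta>)"
    by (rule sum_distrib_left)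
  also have "\<dots> \<le> (\<Sum>j\<in>J. (real j - real n * \<theta>)\<^sup>2 * Bernstein n j \<theta>)"
  proof (intro sum_mono mult_right_mono Bernstein_nonneg \<theta>)
    fix j assume "j \<in> J"
    from far[OF this] have "\<bar>\<delta> * real n\<bar> \<le> \<bar>real j - real n * \<theta>\<bar>"
      using assms(3) by (simp add: abs_mult)
    then show "(\<delta> * real n)\<^sup>2 \<le> (real j - real n * \<theta>)\<^sup>2"
      by (simp only: abs_le_square_iff)
  qed
  also have "\<dots> \<le> (\<Sum>j\<le>n. (real j - real n * \<theta>)\<^sup>2 * Bernstein n j \<theta>)"
    using J \<theta> by (intro sum_mono2) (auto intro!: mult_nonneg_nonneg Bernstein_nonneg)
  also have "\<dots> = real n * (\<theta> * (1 - \<theta>))"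
    by (simp add: Bernstein_variance)
  also have "\<dots> \<le> real n * (1 * 1)"
    using \<theta> by (intro mult_left_mono mult_mono) auto
  finally show ?thesis
    using assms(3,4) by (simp add: field_simps power2_eq_square)
qed

text \<open>The weak law of large numbers: the proportion of successes concentrates at \<theta>,
  while the threshold X sits at proportion \<mu>.\<close>

lemma bin_tail_limit:
  fixes X Y :: "nat \<Rightarrow> nat"
  assumes \<theta>: "0 \<le> \<theta>" "\<theta> \<le> 1" and XY: "filterlim (\<lambda>k. X k + Y k) at_top sequentially"
    and ratio: "(\<lambda>k. real (X k) / real (Suc (X k + Y k))) \<longlonglongrightarrow> \<mu>"
    and "\<mu> \<noteq> \<theta>"
  shows "(\<lambda>k. bin_tail \<theta> (X k) (Y k)) \<longlonglongrightarrow> (if \<mu> < \<theta> then 1 else 0)"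
proof -
  \<comment> \<open>Half the gap: once the ratio has passed the midpoint of \<mu> and \<theta>,
    every index in the sum is at distance at least \<delta> n from the mean n \<theta>.\<close>
  define \<delta> where "\<delta> = \<bar>\<mu> - \<theta>\<bar> / 2"
  have \<delta>: "\<delta> > 0"
    using \<open>\<mu> \<noteq> \<theta>\<close> by (simp add: \<delta>_def)
  have "filterlim (\<lambda>k. Suc (X k + Y k)) at_top sequentially"
    using filterlim_compose[OF filterlim_Suc XY] .
  then have "(\<lambda>k. 1 / real (Suc (X k + Y k))) \<longlonglongrightarrow> 0"
    using filterlim_compose[OF lim_1_over_n[where 'a = real]] by blast
  from tendsto_mult_right[OF this, of "1 / \<delta>\<^sup>2"]
  have bound_0: "(\<lambda>k. 1 / (\<delta>\<^sup>2 * real (Suc (X k + Y k)))) \<longlonglongrightarrow> 0"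
    by (simp add: field_simps)
  have Cheb: "(\<Sum>j\<in>J. Bernstein n j \<theta>) \<le> 1 / (\<delta>\<^sup>2 * real n)"
    if "n > 0" "J \<subseteq> {..n}" "\<And>j. j \<in> J \<Longrightarrow> \<bar>real j - real n * \<theta>\<bar> \<ge> \<delta> * real n" for J n
    using that \<theta> \<delta> by (intro Bernstein_Chebyshev)
  have far_left: "\<delta> * N \<le> \<bar>j - N * \<theta>\<bar>" if "j < (\<theta> - \<delta>) * N" for j N :: real
    using that by (simp add: algebra_simps)
  have far_right: "\<delta> * N \<le> \<bar>j - N * \<theta>\<bar>" if "j > (\<theta> + \<delta>) * N" for j N :: real
    using that by (simp add: algebra_simps)
  show ?thesis
  proof (cases "\<mu> < \<theta>")
    case True
    have "\<forall>\<^sub>F k in sequentially. real (X k) / real (Suc (X k + Y k)) < \<theta> - \<delta>"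
      using True by (intro order_tendstoD[OF ratio]) (simp add: \<delta>_def field_simps)
    then have "\<forall>\<^sub>F k in sequentially. 1 - bin_tail \<theta> (X k) (Y k) \<le> 1 / (\<delta>\<^sup>2 * real (Suc (X k + Y k)))"
    proof eventually_elim
      case (elim k)
      then have X: "real (X k) < (\<theta> - \<delta>) * real (Suc (X k + Y k))"
        by (simp only: pos_divide_less_eq of_nat_0_less_iff zero_less_Suc)
      show ?case
        unfolding bin_tail_complement
      proof (rule Cheb)
        fix j assume "j \<in> {..X k}"
        then have "real j < (\<theta> - \<delta>) * real (Suc (X k + Y k))"
          using X by (auto intro: le_less_trans)
        then show "\<delta> * real (Suc (X k + Y k)) \<le> \<bar>real j - real (Suc (X k + Y k)) * \<theta>\<bar>"
          by (rule far_left)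
      qed auto
    qed
    then have "(\<lambda>k. 1 - bin_tail \<theta> (X k) (Y k)) \<longlonglongrightarrow> 0"
      using bin_tail_range[OF \<theta>] by (intro tendsto_sandwich[OF _ _ tendsto_const bound_0]) auto
    from tendsto_diff[OF tendsto_const[of 1] this] True show ?thesis
      by simp
  next
    case False
    with \<open>\<mu> \<noteq> \<theta>\<close> have "\<theta> < \<mu>"
      by simp
    have "\<forall>\<^sub>F k in sequentially. real (X k) / real (Suc (X k + Y k)) > \<theta> + \<delta>"
      using \<open>\<theta> < \<mu>\<close> by (intro order_tendstoD[OF ratio]) (simp add: \<delta>_def field_simps)
    then have "\<forall>\<^sub>F k in sequentially. bin_tail \<theta> (X k) (Y k) \<le> 1 / (\<delta>\<^sup>2 * real (Suc (X k + Y k)))"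
    proof eventually_elim
      case (elim k)
      then have X: "real (X k) > (\<theta> + \<delta>) * real (Suc (X k + Y k))"
        by (simp only: pos_less_divide_eq of_nat_0_less_iff zero_less_Suc)
      show ?case
        unfolding bin_tail_Bernstein
      proof (rule Cheb)
        fix j assume "j \<in> {Suc (X k)..Suc (X k + Y k)}"
        then have "real j > (\<theta> + \<delta>) * real (Suc (X k + Y k))"
          using X by auto
        then show "\<delta> * real (Suc (X k + Y k)) \<le> \<bar>real j - real (Suc (X k + Y k)) * \<theta>\<bar>"
          by (rule far_right)
      qed auto
    qed
    then have "(\<lambda>k. bin_tail \<theta> (X k) (Y k)) \<longlonglongrightarrow> 0"
      using bin_tail_range[OF \<theta>] by (intro tendsto_sandwich[OF _ _ tendsto_const bound_0]) auto
    with False show ?thesis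
      by simp
  qed
qed

text \<open>Two probabilities differ by at most 1. The kernel of a vertex is thus bounded uniformly
  in both exponents, and domination requires no separate treatment of long shifts.\<close>

lemma conv_bin_coeff_bound:
  assumes "0 < \<alpha>" "\<alpha> < 1" "0 < \<beta>" "\<beta> < 1" "\<alpha> \<noteq> \<beta>"
  shows "\<bar>conv (bin_coeff \<alpha>) (bin_coeff \<beta>) x y\<bar> \<le> 1 / \<bar>\<alpha> - \<beta>\<bar>"
proof -
  have "\<bar>\<alpha> - \<beta>\<bar> * \<bar>conv (bin_coeff \<alpha>) (bin_coeff \<beta>) x y\<bar> = \<bar>bin_tail \<alpha> x y - bin_tail \<beta> x y\<bar>"
    using conv_bin_coeff[OF assms(1-4), of x y] by (simp flip: abs_mult)
  also have "\<dots> \<le> 1"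
    using bin_tail_range[of \<alpha> x y] bin_tail_range[of \<beta> x y] assms by auto
  finally show ?thesis
    using assms by (simp add: field_simps)
qed

text \<open>For \<mu> strictly between, exactly one tail tends to 1, namely that of the larger
  parameter, so its sign agrees with that of \<alpha> - \<beta>. For \<mu> outside the interval the
  two limits would cancel.\<close>

lemma conv_bin_coeff_limit:
  fixes X Y :: "nat \<Rightarrow> nat"
  assumes \<alpha>\<beta>: "0 < \<alpha>" "\<alpha> < 1" "0 < \<beta>" "\<beta> < 1"
    and XY: "filterlim (\<lambda>k. X k + Y k) at_top sequentially"
    and ratio: "(\<lambda>k. real (X k) / real (Suc (X k + Y k))) \<longlonglongrightarrow> \<mu>"
    and between: "\<alpha> < \<mu> \<and> \<mu> < \<beta> \<or> \<beta> < \<mu> \<and> \<mu> < \<alpha>"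
  shows "(\<lambda>k. conv (bin_coeff \<alpha>) (bin_coeff \<beta>) (X k) (Y k)) \<longlonglongrightarrow> 1 / \<bar>\<alpha> - \<beta>\<bar>"
proof -
  have "(\<lambda>k. (bin_tail \<alpha> (X k) (Y k) - bin_tail \<beta> (X k) (Y k)) / (\<alpha> - \<beta>)) \<longlonglongrightarrow>
      ((if \<mu> < \<alpha> then 1 else 0) - (if \<mu> < \<beta> then 1 else 0)) / (\<alpha> - \<beta>)"
    using \<alpha>\<beta> between by (intro tendsto_intros bin_tail_limit[OF _ _ XY ratio]) auto
  moreover have "((if \<mu> < \<alpha> then 1 else 0) - (if \<mu> < \<beta> then 1 else 0)) / (\<alpha> - \<beta>) = 1 / \<bar>\<alpha> - \<beta>\<bar>"
    using between by (auto simp: field_simps)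
  moreover have "(bin_tail \<alpha> x y - bin_tail \<beta> x y) / (\<alpha> - \<beta>) = conv (bin_coeff \<alpha>) (bin_coeff \<beta>) x y" for x y
    using between conv_bin_coeff[OF \<alpha>\<beta>, of x y] by (auto simp: field_simps)
  ultimately show ?thesis
    by simp
qed

section \<open>Asymptotics along a ray\<close>

text \<open>The origin of \<rho>: finitely many strict inequalities survive a slight
  dilation.\<close>

lemma exists_dilation:
  fixes u :: "'i \<Rightarrow> real"
  assumes "finite L" "\<And>l. l \<in> L \<Longrightarrow> u l < 1"
  obtains \<rho> where "\<rho> > 1" "\<And>l. l \<in> L \<Longrightarrow> \<rho> * u l < 1"
proof -
  have "\<forall>\<^sub>F \<rho> in at_right 1. \<rho> * u l < 1" if "l \<in> L" for l
  proof -
    have "((\<lambda>\<rho>. \<rho> * u l) \<longlongrightarrow> 1 * u l) (at_right 1)"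
      by (intro tendsto_intros)
    then show ?thesis
      using assms(2)[OF that] by (intro order_tendstoD) auto
  qed
  then have "\<forall>\<^sub>F \<rho> in at_right 1. \<forall>l\<in>L. \<rho> * u l < 1"
    using assms(1) by (simp add: eventually_ball_finite)
  then have "\<forall>\<^sub>F \<rho> in at_right (1 :: real). \<rho> > 1 \<and> (\<forall>l\<in>L. \<rho> * u l < 1)"
    using eventually_at_right_less[of "1 :: real"] by eventually_elim auto
  then show ?thesis
    using that eventually_happens[of _ "at_right (1 :: real)"] by force
qed

lemma ray_ratio_limit:
  fixes p q s t :: nat
  assumes "p > 0" "q > 0"
  shows "(\<lambda>k. real (k * p - s) / real (Suc (k * p - s + (k * q - t)))) \<longlonglongrightarrow> real p / real (p + q)"
proof -
  have lim: "(\<lambda>k. (real p - real s / real k) / (real (p + q) - (real s + real t) / real k + 1 / real k)) \<longlonglongrightarrow>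
      (real p - 0) / (real (p + q) - 0 + 0)"
    using assms by (intro tendsto_intros lim_const_over_n) (auto simp del: of_nat_add)
  have "\<forall>\<^sub>F k in sequentially. (real p - real s / real k) / (real (p + q) - (real s + real t) / real k + 1 / real k) =
      real (k * p - s) / real (Suc (k * p - s + (k * q - t)))"
    using eventually_gt_at_top[of "s + t"]
  proof eventually_elim
    case (elim k)
    have "k * 1 \<le> k * p" "k * 1 \<le> k * q"
      using assms by (auto simp del: mult_1_right intro!: mult_le_mono2)
    with elim have le: "s \<le> k * p" "t \<le> k * q"
      by linarith+
    have "real (k * p - s) = real k * (real p - real s / real k)"
      using elim by (simp add: of_nat_diff[OF le(1)] right_diff_distrib)
    moreover have "real k * (u - v / real k + 1 / real k) = real k * u - v + 1" for u v :: real
      using elim by (simp add: right_diff_distrib distrib_left)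
    then have "real (Suc (k * p - s + (k * q - t))) =
        real k * (real (p + q) - (real s + real t) / real k + 1 / real k)"
      by (simp add: of_nat_diff[OF le(1)] of_nat_diff[OF le(2)] distrib_left)
    ultimately show ?case
      using elim by (simp only: mult_divide_mult_cancel_left_if) simp
  qed
  from Lim_transform_eventually[OF lim this] show ?thesis
    by simp
qed

lemma ray_coordinate_at_top:
  fixes p s :: nat
  assumes "p > 0"
  shows "filterlim (\<lambda>k. k * p - s) at_top sequentially"
proof (rule filterlim_at_top_mono)
  show "filterlim (\<lambda>k. k - s) at_top sequentially"
    by (rule filterlim_minus_const_nat_at_top)
  show "\<forall>\<^sub>F k in sequentially. k - s \<le> k * p - s"
    using assms by (intro always_eventually allI diff_le_mono) auto
qed

lemma conv_line_coeff_scale: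
  "conv (line_coeff \<alpha> \<beta>) (line_coeff \<gamma> \<delta>) x y * z ^ x * w ^ y =
    conv (line_coeff (\<alpha> * z) (\<beta> * w)) (line_coeff (\<gamma> * z) (\<delta> * w)) x y"
proof -
  have "z ^ x = z ^ (x - s) * z ^ s" "w ^ y = w ^ (y - t) * w ^ t" if "s \<le> x" "t \<le> y" for s t
    using that by (simp_all flip: power_add)
  then show ?thesis
    unfolding conv_def sum_distrib_right by (intro sum.cong) (auto simp: line_coeff_scale)
qed

text \<open>The lines outside \<open>L\<close> form the kernel, those in \<open>L\<close> stay with
  P. The equality is checked only near the origin, where every factor expands; the later limits use
  that \<open>h\<close> converges as far as the lines of \<open>L\<close> alone permit.\<close>

lemma taylor_coeffs_conv:
  fixes a b :: "'i \<Rightarrow> real"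
  assumes taylor: "taylor_coeffs_at_origin f
      (\<lambda>z w. eval2 P z w / (\<Prod>l\<in>A. 1 - of_real (a l) * z - of_real (b l) * w))"
    and A: "finite A" "\<And>l. l \<in> A \<Longrightarrow> a l > 0 \<and> b l > 0"
    and L: "L \<subseteq> A"
    and g: "\<And>z w. (\<And>l. l \<in> A \<Longrightarrow> a l * norm z + b l * norm w < 1) \<Longrightarrow>
        dps_sums g z w (1 / (\<Prod>l\<in>A - L. 1 - of_real (a l) * z - of_real (b l) * w))"
    and h: "\<And>z w. (\<And>l. l \<in> L \<Longrightarrow> a l * norm z + b l * norm w < 1) \<Longrightarrow>
        dps_sums h z w (eval2 P z w / (\<Prod>l\<in>L. 1 - of_real (a l) * z - of_real (b l) * w))"
  shows "f = conv g h"
proof (rule dps_sums_unique)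
  show "\<forall>\<^sub>F (z, w) in nhds (0, 0). dps_sums f z w
      (eval2 P z w / (\<Prod>l\<in>A. 1 - of_real (a l) * z - of_real (b l) * w))"
    using taylor by (simp add: taylor_coeffs_at_origin_def dps_sums_def)
  have "\<forall>\<^sub>F u in nhds (0 :: complex, 0 :: complex). \<forall>l\<in>A. a l * norm (fst u) + b l * norm (snd u) < 1"
    using A eventually_dps_sums_line by (intro eventually_ball_finite) (auto simp: case_prod_unfold)
  then show "\<forall>\<^sub>F (z, w) in nhds (0, 0). dps_sums (conv g h) z w
      (eval2 P z w / (\<Prod>l\<in>A. 1 - of_real (a l) * z - of_real (b l) * w))"
  proof eventually_elim
    case (elim u)
    obtain z w where u: "u = (z, w)"
      by force
    have "dps_sums (conv g h) z w (1 / (\<Prod>l\<in>A - L. 1 - of_real (a l) * z - of_real (b l) * w) *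
        (eval2 P z w / (\<Prod>l\<in>L. 1 - of_real (a l) * z - of_real (b l) * w)))"
      using elim L by (intro dps_sums_conv g h) (auto simp: u)
    then show ?case
      using A(1) L by (simp add: u prod.subset_diff[of L A] mult_ac)
  qed
qed

lemma taylor_ray_asymp_line:
  fixes a b :: "'i \<Rightarrow> real" and p q :: nat
  assumes taylor: "taylor_coeffs_at_origin f
      (\<lambda>z w. eval2 P z w / (\<Prod>l\<in>A. 1 - of_real (a l) * z - of_real (b l) * w))"
    and A: "finite A" "\<And>l. l \<in> A \<Longrightarrow> a l > 0 \<and> b l > 0"
    and i: "i \<in> A" and pq: "p > 0" "q > 0"
    and z: "a i * z = real p / real (p + q)" and w: "b i * w = real q / real (p + q)"
    and others: "\<And>l. l \<in> A - {i} \<Longrightarrow> a l * z + b l * w < 1"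
  obtains c where "c > 0"
    "(\<lambda>k. of_real (sqrt (real k)) * (f (k * p) (k * q) * of_real z ^ (k * p) * of_real w ^ (k * q)))
      \<longlonglongrightarrow> of_real c * (eval2 P (of_real z) (of_real w) /
          (\<Prod>l\<in>A - {i}. 1 - of_real (a l) * of_real z - of_real (b l) * of_real w))"
proof -
  define \<theta> where "\<theta> = real p / real (p + q)"
  have \<theta>: "0 < \<theta>" "\<theta> < 1" "1 - \<theta> = real q / real (p + q)"
    using pq by (auto simp: \<theta>_def field_simps)
  have pos: "a i > 0" "b i > 0" "z > 0" "w > 0"
  proof -
    show ab: "a i > 0" "b i > 0"
      using A i by auto
    have "a i * z > 0" "b i * w > 0"
      unfolding z w using pq by auto
    with ab show "z > 0" "w > 0"
      by (simp_all add: zero_less_mult_iff)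
  qed
  obtain \<rho> where \<rho>: "\<rho> > 1" "\<And>l. l \<in> A - {i} \<Longrightarrow> \<rho> * (a l * z + b l * w) < 1"
    using exists_dilation[of "A - {i}" "\<lambda>l. a l * z + b l * w"] A others by auto
  obtain h where h: "\<And>z w. (\<And>l. l \<in> A - {i} \<Longrightarrow> a l * norm z + b l * norm w < 1) \<Longrightarrow>
      dps_sums h z w (eval2 P z w / (\<Prod>l\<in>A - {i}. 1 - of_real (a l) * z - of_real (b l) * w))"
    using dps_sums_quotient_exists[of "A - {i}" a b P] A by blast
  define g where "g = (\<lambda>x y. complex_of_real (line_coeff (a i) (b i) x y))"
  have f: "f = conv g h"
  proof (rule taylor_coeffs_conv[OF taylor A, of "A - {i}"])
    fix z w :: complex
    assume "\<And>l. l \<in> A \<Longrightarrow> a l * norm z + b l * norm w < 1"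
    moreover have "A - (A - {i}) = {i}"
      using i by auto
    ultimately show "dps_sums g z w (1 / (\<Prod>l\<in>A - (A - {i}). 1 - of_real (a l) * z - of_real (b l) * w))"
      using i pos by (auto simp: g_def intro!: dps_sums_line)
  qed (use h in auto)
  obtain c where c: "c > 0" "(\<lambda>k. bin_coeff \<theta> (k * p) (k * q) * sqrt (real k)) \<longlonglongrightarrow> c"
    using bin_coeff_ray_asymp[OF pq] unfolding \<theta>_def by blast
  obtain C where C: "C \<ge> 0" "\<forall>\<^sub>F k in sequentially. \<forall>s t. s \<le> k * p \<longrightarrow> t \<le> k * q \<longrightarrow>
      bin_ratio \<theta> (k * p) (k * q) s t \<le> C * \<rho> ^ (s + t)"
    using bin_ratio_bound[OF pq \<rho>(1)] unfolding \<theta>_def by blast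
  \<comment> \<open>At the tangency point \<open>a i * z\<close> equals the slope p / (p + q), so
    the rescaled kernel is a binomial probability at exactly the parameter where it decays like 1 /
    sqrt k.\<close>
  have kernel_eq: "of_real (sqrt (real k)) * (g (k * p - s) (k * q - t) * of_real z ^ (k * p - s) * of_real w ^ (k * q - t)) =
      of_real (bin_coeff \<theta> (k * p) (k * q) * sqrt (real k) * bin_ratio \<theta> (k * p) (k * q) s t)" for k s t
  proof -
    have "g (k * p - s) (k * q - t) * of_real z ^ (k * p - s) * of_real w ^ (k * q - t) =
        of_real (bin_coeff \<theta> (k * p - s) (k * q - t))"
      using line_coeff_scale[of "a i" z "b i" w] unfolding z w \<theta>(3)[symmetric] \<theta>_def[symmetric]
      by (simp add: g_def)
    moreover have "bin_coeff \<theta> (k * p - s) (k * q - t) =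
        bin_coeff \<theta> (k * p) (k * q) * bin_ratio \<theta> (k * p) (k * q) s t"
      using bin_coeff_pos[OF \<theta>(1,2), of "k * p" "k * q"] by (simp add: bin_ratio_def)
    ultimately show ?thesis
      by (simp add: mult_ac)
  qed
  have "(\<lambda>k. of_real (sqrt (real k)) * (conv g h (k * p) (k * q) * of_real z ^ (k * p) * of_real w ^ (k * q)))
      \<longlonglongrightarrow> of_real c * (eval2 P (of_real z) (of_real w) /
          (\<Prod>l\<in>A - {i}. 1 - of_real (a l) * of_real z - of_real (b l) * of_real w))"
  proof (rule conv_tendsto)
    show "filterlim (\<lambda>k. k * p) at_top sequentially" "filterlim (\<lambda>k. k * q) at_top sequentially"
      using ray_coordinate_at_top[of p 0] ray_coordinate_at_top[of q 0] pq by auto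
    show "dps_sums h (of_real z) (of_real w) (eval2 P (of_real z) (of_real w) /
          (\<Prod>l\<in>A - {i}. 1 - of_real (a l) * of_real z - of_real (b l) * of_real w))"
      using others pos by (intro h) auto
    show "dps_sums h (of_real \<rho> * of_real z) (of_real \<rho> * of_real w)
         (eval2 P (of_real \<rho> * of_real z) (of_real \<rho> * of_real w) /
          (\<Prod>l\<in>A - {i}. 1 - of_real (a l) * (of_real \<rho> * of_real z) - of_real (b l) * (of_real \<rho> * of_real w)))"
      using \<rho> pos by (intro h) (auto simp: norm_mult algebra_simps)
    show "(\<lambda>k. of_real (sqrt (real k)) * (g (k * p - s) (k * q - t) * of_real z ^ (k * p - s) * of_real w ^ (k * q - t)))
        \<longlonglongrightarrow> of_real c" for s t
      unfolding kernel_eq using tendsto_mult[OF c(2) bin_ratio_limit[OF pq, of s t, folded \<theta>_def]]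
      by (intro tendsto_of_real) simp
    \<comment> \<open>Any bound above the limit c serves for the normalised unshifted kernel; the
      shift contributes C \<rho> ^ (s + t).\<close>
    have "\<forall>\<^sub>F k in sequentially. bin_coeff \<theta> (k * p) (k * q) * sqrt (real k) < c + 1"
      using c by (intro order_tendstoD) auto
    with C(2) show "\<forall>\<^sub>F k in sequentially. \<forall>s t. s \<le> k * p \<longrightarrow> t \<le> k * q \<longrightarrow>
        norm (of_real (sqrt (real k)) * (g (k * p - s) (k * q - t) * of_real z ^ (k * p - s) * of_real w ^ (k * q - t)))
        \<le> (c + 1) * C * \<rho> ^ (s + t)"
    proof eventually_elim
      case (elim k)
      show ?case
      proof (intro allI impI)
        fix s t
        assume "s \<le> k * p" "t \<le> k * q"
        then have "bin_ratio \<theta> (k * p) (k * q) s t \<le> C * \<rho> ^ (s + t)"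
          using elim by blast
        moreover have "bin_ratio \<theta> (k * p) (k * q) s t \<ge> 0" "bin_coeff \<theta> (k * p) (k * q) \<ge> 0"
          using bin_coeff_pos[OF \<theta>(1,2)] by (auto simp: bin_ratio_def less_imp_le)
        ultimately show "norm (of_real (sqrt (real k)) * (g (k * p - s) (k * q - t) * of_real z ^ (k * p - s) *
            of_real w ^ (k * q - t))) \<le> (c + 1) * C * \<rho> ^ (s + t)"
          unfolding kernel_eq norm_of_real using mult_mono[of "bin_coeff \<theta> (k * p) (k * q) * sqrt (real k)" "c + 1"
              "bin_ratio \<theta> (k * p) (k * q) s t" "C * \<rho> ^ (s + t)"] elim(2) c(1)
          by (simp add: mult_ac)
      qed
    qed
  qed (use \<rho> c C in auto)
  then show ?thesis
    using that c(1) f by blast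
qed

text \<open>Both lines through the vertex enter the kernel; since b w = 1 - a z on each, rescaling
  gives binomial kernels with parameters \<open>a i * z\<close> and \<open>a j * z\<close>. Their
  convolution tends to a nonzero constant, so the normalisation is 1.\<close>

lemma taylor_ray_asymp_vertex:
  fixes a b :: "'i \<Rightarrow> real" and p q :: nat
  assumes taylor: "taylor_coeffs_at_origin f
      (\<lambda>z w. eval2 P z w / (\<Prod>l\<in>A. 1 - of_real (a l) * z - of_real (b l) * w))"
    and A: "finite A" "\<And>l. l \<in> A \<Longrightarrow> a l > 0 \<and> b l > 0"
    and ij: "i \<in> A" "j \<in> A" "i \<noteq> j" and pq: "p > 0" "q > 0" and zw: "z > 0" "w > 0"
    and zw_i: "a i * z + b i * w = 1" and zw_j: "a j * z + b j * w = 1"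
    and others: "\<And>l. l \<in> A - {i, j} \<Longrightarrow> a l * z + b l * w < 1"
    and between: "a i * z < real p / real (p + q) \<and> real p / real (p + q) < a j * z \<or>
      a j * z < real p / real (p + q) \<and> real p / real (p + q) < a i * z"
  shows "(\<lambda>k. f (k * p) (k * q) * of_real z ^ (k * p) * of_real w ^ (k * q))
      \<longlonglongrightarrow> of_real (1 / \<bar>a i * z - a j * z\<bar>) * (eval2 P (of_real z) (of_real w) /
          (\<Prod>l\<in>A - {i, j}. 1 - of_real (a l) * of_real z - of_real (b l) * of_real w))"
proof -
  define \<alpha> \<beta> where "\<alpha> = a i * z" and "\<beta> = a j * z"
  have pos: "a i > 0" "b i > 0" "a j > 0" "b j > 0"
    using A ij by auto
  have bw: "b i * w = 1 - \<alpha>" "b j * w = 1 - \<beta>"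
    using zw_i zw_j by (auto simp: \<alpha>_def \<beta>_def)
  have \<alpha>: "0 < \<alpha>" "\<alpha> < 1" and \<beta>: "0 < \<beta>" "\<beta> < 1"
    using pos zw bw mult_pos_pos[of "b i" w] mult_pos_pos[of "b j" w] by (auto simp: \<alpha>_def \<beta>_def)
  have "\<alpha> \<noteq> \<beta>"
    using between by (auto simp: \<alpha>_def \<beta>_def)
  obtain \<rho> where \<rho>: "\<rho> > 1" "\<And>l. l \<in> A - {i, j} \<Longrightarrow> \<rho> * (a l * z + b l * w) < 1"
    using exists_dilation[of "A - {i, j}" "\<lambda>l. a l * z + b l * w"] A others by auto
  obtain h where h: "\<And>z w. (\<And>l. l \<in> A - {i, j} \<Longrightarrow> a l * norm z + b l * norm w < 1) \<Longrightarrow>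
      dps_sums h z w (eval2 P z w / (\<Prod>l\<in>A - {i, j}. 1 - of_real (a l) * z - of_real (b l) * w))"
    using dps_sums_quotient_exists[of "A - {i, j}" a b P] A by blast
  define g where "g = conv (\<lambda>x y. complex_of_real (line_coeff (a i) (b i) x y))
      (\<lambda>x y. complex_of_real (line_coeff (a j) (b j) x y))"
  have f: "f = conv g h"
  proof (rule taylor_coeffs_conv[OF taylor A, of "A - {i, j}"])
    fix z w :: complex
    assume *: "\<And>l. l \<in> A \<Longrightarrow> a l * norm z + b l * norm w < 1"
    have "dps_sums g z w (1 / (1 - of_real (a i) * z - of_real (b i) * w) *
        (1 / (1 - of_real (a j) * z - of_real (b j) * w)))"
      unfolding g_def using * pos ij by (intro dps_sums_conv dps_sums_line) auto
    moreover have "A - (A - {i, j}) = {i, j}"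
      using ij by auto
    ultimately show "dps_sums g z w (1 / (\<Prod>l\<in>A - (A - {i, j}). 1 - of_real (a l) * z - of_real (b l) * w))"
      using ij by simp
  qed (use h in auto)
  have kernel_eq: "1 * (g x y * of_real z ^ x * of_real w ^ y) =
      complex_of_real (conv (bin_coeff \<alpha>) (bin_coeff \<beta>) x y)" for x y
  proof -
    have "g x y * of_real z ^ x * of_real w ^ y = of_real (conv (line_coeff (a i) (b i)) (line_coeff (a j) (b j)) x y * z ^ x * w ^ y)"
      by (simp add: g_def conv_of_real)
    then show ?thesis
      by (simp only: conv_line_coeff_scale bw \<alpha>_def[symmetric] \<beta>_def[symmetric] mult_1)
  qed
  have "(\<lambda>k. 1 * (conv g h (k * p) (k * q) * of_real z ^ (k * p) * of_real w ^ (k * q)))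
      \<longlonglongrightarrow> of_real (1 / \<bar>\<alpha> - \<beta>\<bar>) * (eval2 P (of_real z) (of_real w) /
          (\<Prod>l\<in>A - {i, j}. 1 - of_real (a l) * of_real z - of_real (b l) * of_real w))"
  proof (rule conv_tendsto)
    show "filterlim (\<lambda>k. k * p) at_top sequentially" "filterlim (\<lambda>k. k * q) at_top sequentially"
      using ray_coordinate_at_top[of p 0] ray_coordinate_at_top[of q 0] pq by auto
    show "dps_sums h (of_real z) (of_real w) (eval2 P (of_real z) (of_real w) /
          (\<Prod>l\<in>A - {i, j}. 1 - of_real (a l) * of_real z - of_real (b l) * of_real w))"
      using others zw by (intro h) auto
    show "dps_sums h (of_real \<rho> * of_real z) (of_real \<rho> * of_real w)
         (eval2 P (of_real \<rho> * of_real z) (of_real \<rho> * of_real w) /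
          (\<Prod>l\<in>A - {i, j}. 1 - of_real (a l) * (of_real \<rho> * of_real z) - of_real (b l) * (of_real \<rho> * of_real w)))"
      using \<rho> zw by (intro h) (auto simp: norm_mult algebra_simps)
    show "(\<lambda>k. 1 * (g (k * p - s) (k * q - t) * of_real z ^ (k * p - s) * of_real w ^ (k * q - t)))
        \<longlonglongrightarrow> of_real (1 / \<bar>\<alpha> - \<beta>\<bar>)" for s t
      unfolding kernel_eq
    proof (intro tendsto_of_real conv_bin_coeff_limit \<alpha> \<beta>)
      show "filterlim (\<lambda>k. k * p - s + (k * q - t)) at_top sequentially"
        using ray_coordinate_at_top[OF pq(1), of s] by (rule filterlim_at_top_mono) auto
      show "(\<lambda>k. real (k * p - s) / real (Suc (k * p - s + (k * q - t)))) \<longlonglongrightarrow> real p / real (p + q)"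
        by (rule ray_ratio_limit[OF pq])
    qed (use between in \<open>auto simp: \<alpha>_def \<beta>_def\<close>)
    show "\<forall>\<^sub>F k in sequentially. \<forall>s t. s \<le> k * p \<longrightarrow> t \<le> k * q \<longrightarrow>
        norm (1 * (g (k * p - s) (k * q - t) * of_real z ^ (k * p - s) * of_real w ^ (k * q - t)))
        \<le> 1 / \<bar>\<alpha> - \<beta>\<bar> * \<rho> ^ (s + t)"
      unfolding kernel_eq norm_of_real
    proof (intro always_eventually allI impI)
      fix k s t
      have "1 / \<bar>\<alpha> - \<beta>\<bar> * 1 \<le> 1 / \<bar>\<alpha> - \<beta>\<bar> * \<rho> ^ (s + t)"
        using \<rho>(1) by (intro mult_left_mono) auto
      then show "\<bar>conv (bin_coeff \<alpha>) (bin_coeff \<beta>) (k * p - s) (k * q - t)\<bar> \<le> 1 / \<bar>\<alpha> - \<beta>\<bar> * \<rho> ^ (s + t)"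
        using conv_bin_coeff_bound[OF \<alpha> \<beta> \<open>\<alpha> \<noteq> \<beta>\<close>, of "k * p - s" "k * q - t"] by simp
    qed
  qed (use \<rho> in auto)
  then show ?thesis
    by (simp add: f \<alpha>_def \<beta>_def)
qed

section \<open>The polygon and its cones\<close>

text \<open>The logarithm of the monomial is strictly concave, with gradient (p / z0, q / w0) at
  (z0, w0), so its value drops on the near side of the tangent. The strict case of ln u < u - 1
  makes the maximizer unique.\<close>

lemma monomial_less:
  fixes z w z0 w0 p q :: real
  assumes pq: "p > 0" "q > 0" and zw0: "z0 > 0" "w0 > 0" and zw: "z \<ge> 0" "w \<ge> 0"
    and le: "p * (z / z0) + q * (w / w0) \<le> p + q" and ne: "(z, w) \<noteq> (z0, w0)"
  shows "z powr p * w powr q < z0 powr p * w0 powr q"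
proof (cases "z = 0 \<or> w = 0")
  case True
  then show ?thesis
    using zw0 by auto
next
  case False
  then have zw': "z > 0" "w > 0"
    using zw by auto
  have ln_le: "ln u \<le> u - 1" if "u > 0" for u :: real
    using that ln_le_minus_one by simp
  have ln_less: "ln u < u - 1" if "u > 0" "u \<noteq> 1" for u :: real
    using ln_eq_minus_one[of u] ln_le[of u] that by fastforce
  have "p * ln (z / z0) + q * ln (w / w0) < p * (z / z0 - 1) + q * (w / w0 - 1)"
  proof (cases "z = z0")
    case True
    then have "w / w0 \<noteq> 1"
      using ne zw0 by auto
    then have "q * ln (w / w0) < q * (w / w0 - 1)"
      using pq zw' zw0 by (intro mult_strict_left_mono ln_less) auto
    with True zw0 show ?thesis
      by simp
  next
    case False
    then have "p * ln (z / z0) < p * (z / z0 - 1)"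
      using pq zw' zw0 by (intro mult_strict_left_mono ln_less) auto
    moreover have "q * ln (w / w0) \<le> q * (w / w0 - 1)"
      using pq zw' zw0 by (intro mult_left_mono ln_le) auto
    ultimately show ?thesis
      by linarith
  qed
  also have "\<dots> \<le> 0"
    using le by (simp add: right_diff_distrib)
  finally have "p * ln z + q * ln w < p * ln z0 + q * ln w0"
    using zw' zw0 by (simp add: ln_divide_pos right_diff_distrib)
  then have "exp (p * ln z + q * ln w) < exp (p * ln z0 + q * ln w0)"
    by simp
  then show ?thesis
    using zw' zw0 by (simp add: powr_def exp_add)
qed

corollary monomial_le:
  fixes z w z0 w0 p q :: real
  assumes "p > 0" "q > 0" "z0 > 0" "w0 > 0" "z \<ge> 0" "w \<ge> 0" "p * (z / z0) + q * (w / w0) \<le> p + q"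
  shows "z powr p * w powr q \<le> z0 powr p * w0 powr q"
  using monomial_less[OF assms] by (cases "(z, w) = (z0, w0)") auto

lemma rmonomial_pos_exponents: "p > 0 \<Longrightarrow> q > 0 \<Longrightarrow> rmonomial (p, q) (z, w) = z powr p * w powr q"
  by (simp add: rmonomial_def)

text \<open>The hypotheses on the complex lines, in the real form used by the geometry of the
  polygon.\<close>

locale line_arrangement =
  fixes m :: nat and a b :: "nat \<Rightarrow> real"
  assumes m_pos: "m \<ge> 1"
    and coeff_pos: "i \<in> {1..m} \<Longrightarrow> a i > 0 \<and> b i > 0"
    and not_parallel: "i \<in> {1..m} \<Longrightarrow> j \<in> {1..m} \<Longrightarrow> i \<noteq> j \<Longrightarrow> a i * b j \<noteq> a j * b i"
    and no_triple: "i \<in> {1..m} \<Longrightarrow> j \<in> {1..m} \<Longrightarrow> l \<in> {1..m} \<Longrightarrow> i \<noteq> j \<Longrightarrow> i \<noteq> l \<Longrightarrow> j \<noteq> l \<Longrightarrow>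
      a i * z + b i * w = 1 \<Longrightarrow> a j * z + b j * w = 1 \<Longrightarrow> a l * z + b l * w \<noteq> 1"
begin

definition polygon :: "(real \<times> real) set" where
  "polygon = {(z, w). z \<ge> 0 \<and> w \<ge> 0 \<and> (\<forall>i\<in>{1..m}. a i * z + b i * w \<le> 1)}"

lemma closed_polygon: "closed polygon"
proof -
  have "polygon = {u. 0 \<le> fst u} \<inter> {u. 0 \<le> snd u} \<inter> (\<Inter>i\<in>{1..m}. {u. a i * fst u + b i * snd u \<le> 1})"
    by (auto simp: polygon_def)
  then show ?thesis
    by (auto intro!: closed_Int closed_INT closed_Collect_le continuous_intros)
qed

lemma compact_polygon: "compact polygon"
proof -
  have 1: "1 \<in> {1..m}"
    using m_pos by simp
  have "polygon \<subseteq> cbox (0, 0) (1 / a 1, 1 / b 1)"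
  proof (clarsimp simp: polygon_def)
    fix z w
    assume zw: "0 \<le> z" "0 \<le> w" "\<forall>i\<in>{Suc 0..m}. a i * z + b i * w \<le> 1"
    then have "a 1 * z + b 1 * w \<le> 1"
      using 1 by auto
    moreover have "a 1 * z \<ge> 0" "b 1 * w \<ge> 0"
      using coeff_pos[OF 1] zw by auto
    ultimately have "a 1 * z \<le> 1" "b 1 * w \<le> 1"
      by linarith+
    then show "z \<le> 1 / a (Suc 0) \<and> w \<le> 1 / b (Suc 0)"
      using coeff_pos[OF 1] by (simp add: field_simps)
  qed
  then have "bounded polygon"
    using bounded_cbox bounded_subset by blast
  with closed_polygon show ?thesis
    by (simp add: compact_eq_bounded_closed)
qed

lemma interior_point_exists:
  obtains e where "e > 0" "\<And>i. i \<in> {1..m} \<Longrightarrow> a i * e + b i * e < 1"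
proof
  define S where "S = (\<Sum>i\<in>{1..m}. a i + b i)"
  have S: "S \<ge> 0"
    unfolding S_def using coeff_pos by (intro sum_nonneg) (metis add_nonneg_nonneg less_imp_le)
  then show "1 / (1 + S) > 0"
    by simp
  fix i assume i: "i \<in> {1..m}"
  have "a i + b i \<le> S"
    unfolding S_def using coeff_pos i by (intro member_le_sum) (auto intro: add_nonneg_nonneg less_imp_le)
  then show "a i * (1 / (1 + S)) + b i * (1 / (1 + S)) < 1"
    using S by (simp add: add_divide_distrib[symmetric])
qed

text \<open>A point of the closed polygon is the limit of points on the segment towards the interior
  point (e, e), at which all constraints are strict.\<close>

lemma closure_polygon_M: "closure (polygon_M m a b) = polygon"
proof
  show "closure (polygon_M m a b) \<subseteq> polygon"
    by (rule closure_minimal[OF _ closed_polygon]) (force simp: polygon_M_def polygon_def)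
  show "polygon \<subseteq> closure (polygon_M m a b)"
  proof
    fix v assume "v \<in> polygon"
    then obtain z w where v: "v = (z, w)" and zw: "z \<ge> 0" "w \<ge> 0"
      "\<And>i. i \<in> {1..m} \<Longrightarrow> a i * z + b i * w \<le> 1"
      by (auto simp: polygon_def)
    obtain e where e: "e > 0" "\<And>i. i \<in> {1..m} \<Longrightarrow> a i * e + b i * e < 1"
      by (rule interior_point_exists) blast
    define x where "x n = ((1 - inverse (real (Suc n))) * z + inverse (real (Suc n)) * e,
        (1 - inverse (real (Suc n))) * w + inverse (real (Suc n)) * e)" for n
    have "x n \<in> polygon_M m a b" for n
    proof -
      define t where "t = inverse (real (Suc n))"
      have t: "0 < t" "t \<le> 1"
        by (auto simp: t_def inverse_eq_divide)
      have pos: "(1 - t) * u + t * e > 0" if "u \<ge> 0" for u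
        using t e(1) that by (intro add_nonneg_pos) auto
      have "a i * ((1 - t) * z + t * e) + b i * ((1 - t) * w + t * e) < 1" if i: "i \<in> {1..m}" for i
      proof -
        have "(1 - t) * (a i * z + b i * w) \<le> (1 - t) * 1"
          using t zw(3)[OF i] by (intro mult_left_mono) auto
        moreover have "t * (a i * e + b i * e) < t * 1"
          using t e(2)[OF i] by (intro mult_strict_left_mono) auto
        ultimately show ?thesis
          by (simp add: algebra_simps)
      qed
      then show ?thesis
        using pos[OF zw(1)] pos[OF zw(2)] unfolding x_def t_def[symmetric] polygon_M_def
        by (auto simp: diff_diff_eq)
    qed
    moreover have "x \<longlonglongrightarrow> ((1 - 0) * z + 0 * e, (1 - 0) * w + 0 * e)"
      unfolding x_def by (intro tendsto_intros LIMSEQ_inverse_real_of_nat)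
    ultimately show "v \<in> closure (polygon_M m a b)"
      unfolding closure_sequential v by auto
  qed
qed

text \<open>Compactness gives a maximizer; it avoids the axes because the monomial vanishes there
  but is positive at (e, e).\<close>

lemma polygon_maximizer:
  assumes pq: "p > 0" "q > 0"
  obtains z w where "(z, w) \<in> polygon" "z > 0" "w > 0"
    "\<And>z' w'. (z', w') \<in> polygon \<Longrightarrow> z' powr p * w' powr q \<le> z powr p * w powr q"
proof -
  obtain e where e: "e > 0" "\<And>i. i \<in> {1..m} \<Longrightarrow> a i * e + b i * e < 1"
    by (rule interior_point_exists) blast
  then have ep: "(e, e) \<in> polygon"
    by (force simp: polygon_def)
  have "continuous_on polygon (\<lambda>u. fst u powr p * snd u powr q)"
    using pq by (intro continuous_intros continuous_on_powr') (auto simp: polygon_def)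
  with compact_polygon ep obtain v where v: "v \<in> polygon"
    "\<And>u. u \<in> polygon \<Longrightarrow> fst u powr p * snd u powr q \<le> fst v powr p * snd v powr q"
    using continuous_attains_sup[of polygon "\<lambda>u. fst u powr p * snd u powr q"] by blast
  have "0 < e powr p * e powr q"
    using e by simp
  also have "\<dots> \<le> fst v powr p * snd v powr q"
    using v(2)[OF ep] by simp
  finally have "fst v \<noteq> 0" "snd v \<noteq> 0"
    by auto
  moreover have "fst v \<ge> 0" "snd v \<ge> 0"
    using v(1) by (auto simp: polygon_def)
  ultimately show ?thesis
    using that[of "fst v" "snd v"] v by force
qed

text \<open>At \<open>line_point\<close> the gradient of the logarithm of the monomial is p + q
  times (a i, b i), so line i is itself the tangent.\<close>

lemma line_point_less:
  assumes "i \<in> {1..m}" "p > 0" "q > 0" "z \<ge> 0" "w \<ge> 0" "a i * z + b i * w \<le> 1"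
    and "(z, w) \<noteq> line_point (a i) (b i) (p, q)"
  shows "rmonomial (p, q) (z, w) < rmonomial (p, q) (line_point (a i) (b i) (p, q))"
proof -
  have ab: "a i > 0" "b i > 0"
    using coeff_pos assms(1) by auto
  have "p * (z / (1 / a i * (p / (p + q)))) + q * (w / (1 / b i * (q / (p + q)))) = (p + q) * (a i * z + b i * w)"
    using ab assms(2,3) by (simp add: field_simps)
  also have "\<dots> \<le> (p + q) * 1"
    using assms by (intro mult_left_mono) auto
  finally show ?thesis
    using assms ab unfolding line_point_def prod.case rmonomial_pos_exponents[OF assms(2,3)]
    by (intro monomial_less) auto
qed

text \<open>The cone only prescribes the value of the maximum, but on the half plane bounded by line
  i this value is attained at the tangency point alone.\<close>

lemma cone_K_iff:
  assumes i: "i \<in> {1..m}" and pq: "p > 0" "q > 0"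
  shows "(p, q) \<in> cone_K m a b i \<longleftrightarrow> line_point (a i) (b i) (p, q) \<in> polygon"
proof
  assume "(p, q) \<in> cone_K m a b i"
  then obtain v where v: "v \<in> polygon" "rmonomial (p, q) v = rmonomial (p, q) (line_point (a i) (b i) (p, q))"
    by (fastforce simp: cone_K_def has_max_def closure_polygon_M)
  obtain z w where zw: "v = (z, w)"
    by force
  have "v = line_point (a i) (b i) (p, q)"
    using line_point_less[OF i pq, of z w] v i unfolding zw by (fastforce simp: polygon_def)
  with v show "line_point (a i) (b i) (p, q) \<in> polygon"
    by simp
next
  let ?v = "line_point (a i) (b i) (p, q)"
  assume v: "?v \<in> polygon"
  have le: "rmonomial (p, q) (z, w) \<le> rmonomial (p, q) ?v"
    if "z \<ge> 0" "w \<ge> 0" "a i * z + b i * w \<le> 1" for z w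
    using line_point_less[OF i pq that] by (cases "(z, w) = ?v") auto
  have real_line: "(of_real z, of_real w) \<in> cline (a i) (b i) \<longleftrightarrow> a i * z + b i * w = 1" for z w
  proof -
    have "(of_real z, of_real w) \<in> cline (a i) (b i) \<longleftrightarrow> complex_of_real (1 - a i * z - b i * w) = of_real 0"
      by (simp add: cline_def eval2_lin_poly)
    then show ?thesis
      unfolding of_real_eq_iff by linarith
  qed
  obtain z w where zw: "?v = (z, w)"
    by force
  have "a i * z + b i * w = 1"
  proof -
    have "a i * z + b i * w = p / (p + q) + q / (p + q)"
      using zw coeff_pos[OF i] by (auto simp: line_point_def)
    then show ?thesis
      using pq by (simp add: add_divide_distrib[symmetric])
  qed
  then have "?v \<in> {(z, w). z \<ge> 0 \<and> w \<ge> 0 \<and> (of_real z, of_real w) \<in> cline (a i) (b i)}"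
    using v zw by (auto simp: real_line polygon_def)
  moreover have "rmonomial (p, q) u \<le> rmonomial (p, q) ?v" if "u \<in> polygon" for u
    using that i by (cases u) (auto simp: polygon_def intro: le)
  ultimately show "(p, q) \<in> cone_K m a b i"
    using v pq unfolding cone_K_def has_max_def closure_polygon_M
    by (auto simp: real_line intro!: le)
qed

text \<open>Multiplied by p + q, the strict inequalities at the tangency point become linear in (p,
  q), so they define an open set inside the cone.\<close>

lemma interior_cone_K:
  assumes i: "i \<in> {1..m}" and pq: "p > 0" "q > 0"
    and less: "\<And>j. j \<in> {1..m} - {i} \<Longrightarrow>
      a j * fst (line_point (a i) (b i) (p, q)) + b j * snd (line_point (a i) (b i) (p, q)) < 1"
  shows "(p, q) \<in> interior (cone_K m a b i)"
proof (rule interiorI)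
  have ab: "a i > 0" "b i > 0"
    using coeff_pos i by auto
  define T where "T = {u. 0 < fst u} \<inter> {u. 0 < snd u} \<inter>
    (\<Inter>j\<in>{1..m} - {i}. {u :: real \<times> real. a j / a i * fst u + b j / b i * snd u < fst u + snd u})"
  have less_iff: "a j * fst (line_point (a i) (b i) (p, q)) + b j * snd (line_point (a i) (b i) (p, q)) < 1
      \<longleftrightarrow> a j / a i * p + b j / b i * q < p + q" if "p > 0" "q > 0" for p q j
  proof -
    have "a j * fst (line_point (a i) (b i) (p, q)) + b j * snd (line_point (a i) (b i) (p, q)) =
        (a j / a i * p + b j / b i * q) / (p + q)"
      by (simp add: line_point_def add_divide_distrib)
    then show ?thesis
      using that by simp
  qed
  show "open T"
    unfolding T_def by (intro open_Int open_INT ballI open_Collect_less continuous_intros) auto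
  show "(p, q) \<in> T"
    using pq less by (auto simp: T_def less_iff)
  show "T \<subseteq> cone_K m a b i"
  proof
    fix u assume u: "u \<in> T"
    obtain p q where pq: "u = (p, q)" "p > 0" "q > 0"
      using u by (cases u) (auto simp: T_def)
    obtain z w where zw: "line_point (a i) (b i) (p, q) = (z, w)"
      by force
    have "a j * z + b j * w \<le> 1" if "j \<in> {1..m}" for j
    proof (cases "j = i")
      case True
      have "a i * z + b i * w = p / (p + q) + q / (p + q)"
        using zw ab by (auto simp: line_point_def)
      then show ?thesis
        using pq True by (simp add: add_divide_distrib[symmetric])
    next
      case False
      then have "a j / a i * p + b j / b i * q < p + q"
        using u that by (auto simp: T_def pq)
      then show ?thesis
        using less_iff[OF pq(2,3), of j] zw by simp
    qed
    moreover have "z \<ge> 0" "w \<ge> 0"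
      using zw pq ab by (auto simp: line_point_def)
    ultimately show "u \<in> cone_K m a b i"
      using cone_K_iff[OF i pq(2,3)] zw by (auto simp: pq polygon_def)
  qed
qed

lemma crossing_point_eqI:
  assumes "i \<in> {1..m}" "j \<in> {1..m}" "i \<noteq> j" "a i * z + b i * w = 1" "a j * z + b j * w = 1"
  shows "crossing_point a b i j = (z, w)"
  unfolding crossing_point_def
proof (rule the_equality)
  fix u assume "case u of (z, w) \<Rightarrow> 1 - a i * z - b i * w = 0 \<and> 1 - a j * z - b j * w = 0"
  then obtain z' w' where u: "u = (z', w')" and eqs: "a i * z' + b i * w' = 1" "a j * z' + b j * w' = 1"
    by (cases u) auto
  \<comment> \<open>Cramer's rule for the difference of two solutions.\<close>
  have "(a i * b j - a j * b i) * (z' - z) = b j * ((a i * z' + b i * w') - (a i * z + b i * w)) -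
      b i * ((a j * z' + b j * w') - (a j * z + b j * w))"
    by (simp add: algebra_simps)
  moreover have "(a i * b j - a j * b i) * (w' - w) = a i * ((a j * z' + b j * w') - (a j * z + b j * w)) -
      a j * ((a i * z' + b i * w') - (a i * z + b i * w))"
    by (simp add: algebra_simps)
  ultimately show "u = (z, w)"
    using assms eqs not_parallel[OF assms(1-3)] by (simp add: u)
qed (use assms in auto)

lemma crossing_point_on_lines:
  assumes "i \<in> {1..m}" "j \<in> {1..m}" "i \<noteq> j" "crossing_point a b i j = (z, w)"
  shows "a i * z + b i * w = 1" "a j * z + b j * w = 1"
proof -
  let ?D = "a i * b j - a j * b i"
  have D: "?D \<noteq> 0"
    using not_parallel[OF assms(1-3)] by simp
  have "a i * ((b j - b i) / ?D) + b i * ((a i - a j) / ?D) = 1"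
    "a j * ((b j - b i) / ?D) + b j * ((a i - a j) / ?D) = 1"
  proof -
    have num: "a i * (b j - b i) + b i * (a i - a j) = ?D" "a j * (b j - b i) + b j * (a i - a j) = ?D"
      by (simp_all add: algebra_simps)
    have "\<alpha> * ((b j - b i) / d) + \<beta> * ((a i - a j) / d) = (\<alpha> * (b j - b i) + \<beta> * (a i - a j)) / d" for \<alpha> \<beta> d
      by (simp add: add_divide_distrib)
    then show "a i * ((b j - b i) / ?D) + b i * ((a i - a j) / ?D) = 1"
      "a j * ((b j - b i) / ?D) + b j * ((a i - a j) / ?D) = 1"
      using D by (simp_all only: num divide_self_if if_False)
  qed
  from crossing_point_eqI[OF assms(1-3) this] this show "a i * z + b i * w = 1" "a j * z + b j * w = 1"
    using assms(4) by auto
qed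

text \<open>The two inequalities say that the gradient (p / z, q / w) is a positive combination of
  the normals of lines i and j. The tangent inequality then follows from these two constraints, and
  both conditions are open in (p, q).\<close>

lemma interior_cone_Omega:
  assumes ij: "i \<in> {1..m}" "j \<in> {1..m}" and pq: "p > 0" "q > 0"
    and v: "(z, w) \<in> polygon" "z > 0" "w > 0" "a i * z + b i * w = 1" "a j * z + b j * w = 1"
    and between: "a i * z < p / (p + q)" "p / (p + q) < a j * z"
  shows "(p, q) \<in> interior (cone_Omega m a b i j)"
proof (rule interiorI)
  have "i \<noteq> j"
    using between by auto
  then have cross: "crossing_point a b i j = (z, w)"
    using crossing_point_eqI ij v by blast
  define T where "T = {u. 0 < fst u} \<inter> {u. 0 < snd u} \<inter> {u. a i * z * (fst u + snd u) < fst u} \<inter>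
    {u :: real \<times> real. fst u < a j * z * (fst u + snd u)}"
  show "open T"
    unfolding T_def by (intro open_Int open_Collect_less continuous_intros)
  show "(p, q) \<in> T"
    using pq between by (auto simp: T_def field_simps)
  show "T \<subseteq> cone_Omega m a b i j"
  proof
    fix u assume u: "u \<in> T"
    obtain p q where pq: "u = (p, q)" "p > 0" "q > 0"
      using u by (cases u) (auto simp: T_def)
    have lt: "a i * z * (p + q) < p" "p < a j * z * (p + q)"
      using u by (auto simp: T_def pq)
    define d where "d = a j * z - a i * z"
    have d: "d > 0"
      using between by (simp add: d_def)
    \<comment> \<open>The Lagrange multipliers of lines i and j: the solution of r + s = p + q and r
      (a i z) + s (a j z) = p.\<close>
    define r s where "r = (a j * z * (p + q) - p) / d" and "s = (p - a i * z * (p + q)) / d"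
    have nonneg: "r \<ge> 0" "s \<ge> 0"
      using lt d by (auto simp: r_def s_def)
    have sum: "r + s = p + q" and p: "r * (a i * z) + s * (a j * z) = p"
    proof -
      have "d * (r + s) = d * (p + q)" "d * (r * (a i * z) + s * (a j * z)) = d * p"
        using d by (simp_all add: r_def s_def distrib_left) (simp_all add: d_def algebra_simps)
      then show "r + s = p + q" "r * (a i * z) + s * (a j * z) = p"
        using d by auto
    qed
    have q: "r * (b i * w) + s * (b j * w) = q"
    proof -
      have "r * (b i * w) + s * (b j * w) = r * (1 - a i * z) + s * (1 - a j * z)"
        using v by (metis add_diff_cancel_left')
      then show ?thesis
        using sum p by (simp add: algebra_simps)
    qed
    have "z' powr p * w' powr q \<le> z powr p * w powr q" if u': "(z', w') \<in> polygon" for z' w'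
    proof (rule monomial_le)
      have "p * (z' / z) + q * (w' / w) = r * (a i * z' + b i * w') + s * (a j * z' + b j * w')"
      proof -
        have "p * (z' / z) = (r * a i + s * a j) * z'" "q * (w' / w) = (r * b i + s * b j) * w'"
          unfolding p[symmetric] q[symmetric] using v by (simp_all add: field_simps)
        then show ?thesis
          by (simp add: algebra_simps)
      qed
      also have "\<dots> \<le> r * 1 + s * 1"
        using nonneg u' ij by (intro add_mono mult_left_mono) (auto simp: polygon_def)
      finally show "p * (z' / z) + q * (w' / w) \<le> p + q"
        using sum by simp
    qed (use pq v u' in \<open>auto simp: polygon_def\<close>)
    then show "u \<in> cone_Omega m a b i j"
      using v(1) pq by (auto simp: cone_Omega_def has_max_def closure_polygon_M cross rmonomial_pos_exponents)
  qed
qed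

section \<open>Maximizers and the cones away from critical directions\<close>

text \<open>First-order condition in the direction \<sigma> (z (1 - c), - w c). An active line
  changes at rate \<sigma> (a l z - c) and the logarithm of the monomial at rate \<sigma> (p (1 - c)
  - q c), so c acts as a threshold with which both \<open>a l * z\<close> and p / (p + q) are
  compared.\<close>

lemma no_ascent:
  assumes v: "(z, w) \<in> polygon" "z > 0" "w > 0" and pq: "p > 0" "q > 0"
    and max: "\<And>z' w'. (z', w') \<in> polygon \<Longrightarrow> z' powr p * w' powr q \<le> z powr p * w powr q"
    and active: "\<And>l. l \<in> {1..m} \<Longrightarrow> a l * z + b l * w = 1 \<Longrightarrow> \<sigma> * (a l * z - c) \<le> 0"
  shows "\<sigma> * (p * (1 - c) - q * c) \<le> 0"
proof (rule ccontr)
  assume "\<not> \<sigma> * (p * (1 - c) - q * c) \<le> 0"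
  then have slope: "\<sigma> * (p * (1 - c) - q * c) > 0"
    by simp
  define zt wt where "zt t = z * (1 + t * (\<sigma> * (1 - c)))" and "wt t = w * (1 - t * (\<sigma> * c))" for t
  \<comment> \<open>The logarithm of the monomial along this path, minus its value at the
    start.\<close>
  define \<phi> where "\<phi> t = p * ln (1 + t * (\<sigma> * (1 - c))) + q * ln (1 - t * (\<sigma> * c))" for t
  have "(\<phi> has_real_derivative (p * (\<sigma> * (1 - c)) - q * (\<sigma> * c))) (at 0)"
    unfolding \<phi>_def by (auto intro!: derivative_eq_intros)
  moreover have "p * (\<sigma> * (1 - c)) - q * (\<sigma> * c) > 0"
    using slope by (simp add: algebra_simps)
  ultimately obtain d where d: "d > 0" "\<And>h. h > 0 \<Longrightarrow> h < d \<Longrightarrow> \<phi> 0 < \<phi> (0 + h)"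
    using DERIV_pos_inc_right by blast
  have lim: "((\<lambda>t. 1 + t * u) \<longlongrightarrow> 1 + 0 * u) (at_right (0 :: real))" for u
    by (intro tendsto_intros)
  have ev1: "\<forall>\<^sub>F t in at_right 0. 1 + t * (\<sigma> * (1 - c)) > 0"
    by (rule order_tendstoD(1)[OF lim]) simp
  have ev2: "\<forall>\<^sub>F t in at_right 0. 1 + t * (- (\<sigma> * c)) > 0"
    by (rule order_tendstoD(1)[OF lim]) simp
  have ev3: "\<forall>\<^sub>F t in at_right (0 :: real). 0 < t \<and> t < d"
    using d(1) by (auto simp: eventually_at_right_field)
  have ev4: "\<forall>\<^sub>F t in at_right 0. \<forall>l\<in>{1..m}. a l * zt t + b l * wt t \<le> 1"
  proof (intro eventually_ball_finite ballI)
    fix l assume l: "l \<in> {1..m}"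
    show "\<forall>\<^sub>F t in at_right 0. a l * zt t + b l * wt t \<le> 1"
    proof (cases "a l * z + b l * w = 1")
      case True
      have "a l * zt t + b l * wt t = 1 + t * (\<sigma> * (a l * z - c))" for t
      proof -
        have "a l * zt t + b l * wt t = (a l * z + b l * w) + t * (\<sigma> * (a l * z - c * (a l * z + b l * w)))"
          by (simp add: zt_def wt_def algebra_simps)
        then show ?thesis
          using True by simp
      qed
      then show ?thesis
        using ev3 active[OF l True] by (auto elim!: eventually_mono simp: mult_nonneg_nonpos)
    next
      case False
      then have less: "a l * z + b l * w < 1"
        using v(1) l by (force simp: polygon_def)
      have "((\<lambda>t. a l * zt t + b l * wt t) \<longlongrightarrow> a l * (z * (1 + 0 * (\<sigma> * (1 - c)))) + b l * (w * (1 - 0 * (\<sigma> * c)))) (at_right 0)"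
        unfolding zt_def wt_def by (intro tendsto_intros)
      then have "\<forall>\<^sub>F t in at_right 0. a l * zt t + b l * wt t < 1"
        by (rule order_tendstoD) (use less in simp)
      then show ?thesis
        by eventually_elim simp
    qed
  qed auto
  from ev1 ev2 ev3 ev4 have "\<forall>\<^sub>F t in at_right (0 :: real). False"
  proof eventually_elim
    case (elim t)
    have pos: "zt t > 0" "wt t > 0"
      using elim v by (auto simp: zt_def wt_def)
    then have "(zt t, wt t) \<in> polygon"
      using elim(4) by (auto simp: polygon_def)
    then have "zt t powr p * wt t powr q \<le> z powr p * w powr q"
      by (rule max)
    then have "exp (p * ln (zt t) + q * ln (wt t)) \<le> exp (p * ln z + q * ln w)"
      using pos v by (simp add: powr_def exp_add)
    then have "p * ln (zt t) + q * ln (wt t) \<le> p * ln z + q * ln w"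
      by simp
    moreover have "ln (zt t) = ln z + ln (1 + t * (\<sigma> * (1 - c)))" "ln (wt t) = ln w + ln (1 - t * (\<sigma> * c))"
      unfolding zt_def wt_def using elim v by (auto intro!: ln_mult_pos)
    ultimately have "\<phi> t \<le> 0"
      by (simp add: \<phi>_def algebra_simps)
    moreover have "\<phi> 0 < \<phi> t"
      using d(2)[of t] elim by simp
    ultimately show False
      by (simp add: \<phi>_def)
  qed
  then show False
    by simp
qed

text \<open>If all active values \<open>a l * z\<close> lay strictly on one side of p / (p + q), the
  one closest to it, taken as threshold, would give an ascent. The indices i and j may coincide,
  which is the tangent case.\<close>

lemma maximizer_active_lines:
  assumes v: "(z, w) \<in> polygon" "z > 0" "w > 0" and pq: "p > 0" "q > 0"
    and max: "\<And>z' w'. (z', w') \<in> polygon \<Longrightarrow> z' powr p * w' powr q \<le> z powr p * w powr q"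
  obtains i j where "i \<in> {1..m}" "a i * z + b i * w = 1" "a i * z \<le> p / (p + q)"
    "j \<in> {1..m}" "a j * z + b j * w = 1" "p / (p + q) \<le> a j * z"
proof -
  define \<theta> where "\<theta> = p / (p + q)"
  have slope: "p * (1 - c) - q * c = (p + q) * (\<theta> - c)" for c
    using pq by (simp add: \<theta>_def field_simps)
  define S where "S = (\<lambda>l. a l * z) ` {l \<in> {1..m}. a l * z + b l * w = 1}"
  have S: "finite S"
    by (simp add: S_def)
  have "\<exists>j\<in>{1..m}. a j * z + b j * w = 1 \<and> \<theta> \<le> a j * z"
  proof (rule ccontr)
    assume "\<not> ?thesis"
    then have "\<And>s. s \<in> S \<Longrightarrow> s < \<theta>"
      by (force simp: S_def)
    \<comment> \<open>The inserted value \<theta> - 1 only keeps the set nonempty in case no line is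
      active.\<close>
    then have less: "Max (insert (\<theta> - 1) S) < \<theta>"
      using S by simp
    have "1 * (p * (1 - Max (insert (\<theta> - 1) S)) - q * Max (insert (\<theta> - 1) S)) \<le> 0"
    proof (rule no_ascent[OF v pq max])
      fix l assume "l \<in> {1..m}" "a l * z + b l * w = 1"
      then have "a l * z \<le> Max (insert (\<theta> - 1) S)"
        using S by (intro Max_ge) (auto simp: S_def)
      then show "1 * (a l * z - Max (insert (\<theta> - 1) S)) \<le> 0"
        by simp
    qed
    then show False
      using less pq unfolding slope by (simp add: mult_le_0_iff)
  qed
  moreover have "\<exists>i\<in>{1..m}. a i * z + b i * w = 1 \<and> a i * z \<le> \<theta>"
  proof (rule ccontr)
    assume "\<not> ?thesis"
    then have "\<And>s. s \<in> S \<Longrightarrow> s > \<theta>"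
      by (force simp: S_def)
    then have less: "Min (insert (\<theta> + 1) S) > \<theta>"
      using S by simp
    have "- 1 * (p * (1 - Min (insert (\<theta> + 1) S)) - q * Min (insert (\<theta> + 1) S)) \<le> 0"
    proof (rule no_ascent[OF v pq max])
      fix l assume "l \<in> {1..m}" "a l * z + b l * w = 1"
      then have "Min (insert (\<theta> + 1) S) \<le> a l * z"
        using S by (intro Min_le) (auto simp: S_def)
      then show "- 1 * (a l * z - Min (insert (\<theta> + 1) S)) \<le> 0"
        by simp
    qed
    then show False
      using less pq unfolding slope by (simp add: mult_le_0_iff zero_le_mult_iff)
  qed
  ultimately show ?thesis
    using that by (auto simp: \<theta>_def)
qed

text \<open>The values of p / (p + q) for which the tangency point on some line lies on another line
  as well: on line i the first coordinate is determined by \<open>a i * z\<close>, which is p / (p +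
  q) at the tangency point.\<close>

definition critical :: "real set" where
  "critical = (\<lambda>(i, j). a i * fst (crossing_point a b i j)) ` {(i, j) \<in> {1..m} \<times> {1..m}. i \<noteq> j}"

lemma finite_critical: "finite critical"
  unfolding critical_def by (intro finite_imageI finite_subset[OF _ finite_cartesian_product[of "{1..m}" "{1..m}"]]) auto

lemma critical_I:
  assumes "i \<in> {1..m}" "j \<in> {1..m}" "i \<noteq> j" "a i * z + b i * w = 1" "a j * z + b j * w = 1"
  shows "a i * z \<in> critical"
  unfolding critical_def using assms crossing_point_eqI[OF assms] by (intro image_eqI[of _ _ "(i, j)"]) auto

lemma line_point_on_line:
  assumes "i \<in> {1..m}" "p > 0" "q > 0" "line_point (a i) (b i) (p, q) = (z, w)"
  shows "z > 0" "w > 0" "a i * z = p / (p + q)" "b i * w = q / (p + q)" "a i * z + b i * w = 1"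
proof -
  show *: "z > 0" "w > 0" "a i * z = p / (p + q)" "b i * w = q / (p + q)"
    using assms coeff_pos[OF assms(1)] by (auto simp: line_point_def)
  show "a i * z + b i * w = 1"
    unfolding * using assms by (simp add: add_divide_distrib[symmetric])
qed

lemma cone_K_strict:
  assumes i: "i \<in> {1..m}" and pq: "p > 0" "q > 0" and K: "(p, q) \<in> cone_K m a b i"
    and generic: "p / (p + q) \<notin> critical" and j: "j \<in> {1..m} - {i}"
    and zw: "line_point (a i) (b i) (p, q) = (z, w)"
  shows "a j * z + b j * w < 1"
proof -
  have "a j * z + b j * w \<le> 1"
    using K j zw unfolding cone_K_iff[OF i pq] by (auto simp: polygon_def)
  moreover have "a j * z + b j * w \<noteq> 1"
    using critical_I[OF i, of j z w] line_point_on_line[OF i pq zw] j generic by auto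
  ultimately show ?thesis
    by simp
qed

text \<open>Lets the constant depend on (p, q) without mention of i. Two tangency points in the
  polygon would each strictly beat the other unless they coincide, and then they form a crossing,
  which is critical.\<close>

lemma cone_K_unique:
  assumes ij: "i \<in> {1..m}" "j \<in> {1..m}" and pq: "p > 0" "q > 0" and generic: "p / (p + q) \<notin> critical"
    and K: "(p, q) \<in> cone_K m a b i" "(p, q) \<in> cone_K m a b j"
  shows "i = j"
proof (rule ccontr)
  assume "i \<noteq> j"
  obtain z w z' w' where zw: "line_point (a i) (b i) (p, q) = (z, w)" "line_point (a j) (b j) (p, q) = (z', w')"
    by force
  have poly: "(z, w) \<in> polygon" "(z', w') \<in> polygon"
    using K ij pq zw by (auto simp: cone_K_iff)
  have "(z, w) = (z', w')"
  proof (rule ccontr)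
    assume "(z, w) \<noteq> (z', w')"
    then have "rmonomial (p, q) (z, w) < rmonomial (p, q) (z', w')"
      "rmonomial (p, q) (z', w') < rmonomial (p, q) (z, w)"
      using line_point_less[OF ij(1) pq, of z' w'] line_point_less[OF ij(2) pq, of z w] zw poly ij
      by (auto simp: polygon_def)
    then show False
      by simp
  qed
  then have "a j * z + b j * w = 1"
    using line_point_on_line[OF ij(2) pq zw(2)] by simp
  with cone_K_strict[OF ij(1) pq K(1) generic _ zw(1), of j] ij \<open>i \<noteq> j\<close> show False
    by simp
qed

lemma cone_K_generic_interior:
  assumes "i \<in> {1..m}" "p > 0" "q > 0" "(p, q) \<in> cone_K m a b i" "p / (p + q) \<notin> critical"
  shows "(p, q) \<in> interior (cone_K m a b i)"
  using cone_K_strict[OF assms] by (intro interior_cone_K assms(1-3)) (metis prod.collapse)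

text \<open>The maximizer either has an active line tangent to the level curve, which leads to a
  cone K, or lies on two active lines with p / (p + q) strictly between their values, which leads to
  a cone \<Omega>.\<close>

lemma generic_in_interior:
  assumes pq: "p > 0" "q > 0" and generic: "p / (p + q) \<notin> critical"
  shows "(\<exists>i\<in>{1..m}. (p, q) \<in> interior (cone_K m a b i)) \<or>
    (\<exists>(i, j)\<in>Omega_pairs m a b. (p, q) \<in> interior (cone_Omega m a b i j))"
proof -
  obtain z w where v: "(z, w) \<in> polygon" "z > 0" "w > 0"
    and max: "\<And>z' w'. (z', w') \<in> polygon \<Longrightarrow> z' powr p * w' powr q \<le> z powr p * w powr q"
    using polygon_maximizer[OF pq] by blast
  obtain i j where i: "i \<in> {1..m}" "a i * z + b i * w = 1" "a i * z \<le> p / (p + q)"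
    and j: "j \<in> {1..m}" "a j * z + b j * w = 1" "p / (p + q) \<le> a j * z"
    using maximizer_active_lines[OF v pq max] by blast
  have tangent: "(p, q) \<in> interior (cone_K m a b l)"
    if l: "l \<in> {1..m}" "a l * z + b l * w = 1" "a l * z = p / (p + q)" for l
  proof (rule cone_K_generic_interior[OF l(1) pq _ generic])
    have bw: "b l * w = q / (p + q)"
      using l(2) unfolding l(3) using pq by (simp add: field_simps)
    then have "line_point (a l) (b l) (p, q) = (z, w)"
      using coeff_pos[OF l(1)] unfolding line_point_def prod.case l(3)[symmetric] bw[symmetric]
      by simp
    then show "(p, q) \<in> cone_K m a b l"
      using v(1) cone_K_iff[OF l(1) pq] by simp
  qed
  show ?thesis
  proof (cases "a i * z = p / (p + q) \<or> a j * z = p / (p + q)")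
    case True
    then show ?thesis
      using tangent i j by blast
  next
    case False
    then have "a i * z < p / (p + q)" "p / (p + q) < a j * z" "i \<noteq> j"
      using i j by auto
    moreover from this have "crossing_point a b i j = (z, w)"
      using i j by (intro crossing_point_eqI)
    ultimately show ?thesis
      using interior_cone_Omega[OF i(1) j(1) pq v i(2) j(2)] i j v by (fastforce simp: Omega_pairs_def)
  qed
qed

text \<open>A value of the monomial can be attained outside the polygon as well; but on an open set of
  exponents the logarithm of the maximum is then linear, and its gradient identifies the maximizer.\<close>

lemma interior_cone_Omega_crossing:
  assumes ij: "(i, j) \<in> Omega_pairs m a b" and pq: "p > 0" "q > 0"
    and int: "(p, q) \<in> interior (cone_Omega m a b i j)" and zw: "crossing_point a b i j = (z, w)"
  shows "(z, w) \<in> polygon"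
    and "\<And>z' w'. (z', w') \<in> polygon \<Longrightarrow> z' powr p * w' powr q \<le> z powr p * w powr q"
proof -
  have pos: "z > 0" "w > 0"
    using ij zw by (auto simp: Omega_pairs_def)
  have Omega: "has_max (rmonomial (p', q')) polygon (rmonomial (p', q') (z, w))"
    if "(p', q') \<in> cone_Omega m a b i j" for p' q'
    using that by (simp add: cone_Omega_def closure_polygon_M zw)
  have "has_max (rmonomial (p, q)) polygon (rmonomial (p, q) (z, w))"
    using int interior_subset by (intro Omega) blast
  then obtain v where v: "v \<in> polygon" "rmonomial (p, q) v = rmonomial (p, q) (z, w)"
    and max: "\<And>u. u \<in> polygon \<Longrightarrow> rmonomial (p, q) u \<le> rmonomial (p, q) (z, w)"
    by (auto simp: has_max_def)
  show "z' powr p * w' powr q \<le> z powr p * w powr q" if "(z', w') \<in> polygon" for z' w'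
    using max[OF that] pq by (simp add: rmonomial_pos_exponents)
  obtain x y where xy: "v = (x, y)"
    by force
  have eq: "x powr p * y powr q = z powr p * w powr q"
    using v(2) pq by (simp add: xy rmonomial_pos_exponents)
  then have "x \<noteq> 0" "y \<noteq> 0"
    using pos by auto
  moreover have "x \<ge> 0" "y \<ge> 0"
    using v(1) by (auto simp: xy polygon_def)
  ultimately have xy_pos: "x > 0" "y > 0"
    by auto
  define A B where "A = ln x - ln z" and "B = ln y - ln w"
  have ln_monomial: "ln (u powr p' * u' powr q') = p' * ln u + q' * ln u'" if "u > 0" "u' > 0" for u u' p' q' :: real
    using that by (subst ln_mult_pos) (auto simp: ln_powr)
  have zero: "p * A + q * B = 0"
    using arg_cong[OF eq, of ln] pos xy_pos by (simp add: ln_monomial A_def B_def algebra_simps)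
  have le: "p' * A + q' * B \<le> 0" if "(p', q') \<in> cone_Omega m a b i j" "p' > 0" "q' > 0" for p' q'
  proof -
    have "rmonomial (p', q') (x, y) \<le> rmonomial (p', q') (z, w)"
      using Omega[OF that(1)] v(1) by (auto simp: has_max_def xy)
    then have "x powr p' * y powr q' \<le> z powr p' * w powr q'"
      using that by (simp add: rmonomial_pos_exponents)
    then have "ln (x powr p' * y powr q') \<le> ln (z powr p' * w powr q')"
      using pos xy_pos by simp
    then show ?thesis
      using pos xy_pos by (simp add: ln_monomial A_def B_def algebra_simps)
  qed
  \<comment> \<open>Moving the exponents in the direction (A, B) itself makes the form p' A + q' B
    equal to t (A^2 + B^2), since it vanishes at (p, q); yet inside the cone it cannot be
    positive.\<close>
  have ev: "\<forall>\<^sub>F t in at_right 0. (p + t * A, q + t * B) \<in> interior (cone_Omega m a b i j) \<and> p + t * A > 0 \<and> q + t * B > 0"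
  proof (intro eventually_conj)
    have "((\<lambda>t. (p + t * A, q + t * B)) \<longlongrightarrow> (p + 0 * A, q + 0 * B)) (at_right 0)"
      by (intro tendsto_intros)
    then show "\<forall>\<^sub>F t in at_right 0. (p + t * A, q + t * B) \<in> interior (cone_Omega m a b i j)"
      by (rule topological_tendstoD) (use int in auto)
    have "((\<lambda>t. p + t * A) \<longlongrightarrow> p + 0 * A) (at_right 0)" "((\<lambda>t. q + t * B) \<longlongrightarrow> q + 0 * B) (at_right 0)"
      by (intro tendsto_intros)+
    then show "\<forall>\<^sub>F t in at_right 0. p + t * A > 0" "\<forall>\<^sub>F t in at_right 0. q + t * B > 0"
      using pq by (auto intro: order_tendstoD)
  qed
  have "\<forall>\<^sub>F t in at_right (0 :: real). A\<^sup>2 + B\<^sup>2 \<le> 0"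
    using ev eventually_at_right_less[of 0]
  proof eventually_elim
    case (elim t)
    then have "(p + t * A) * A + (q + t * B) * B \<le> 0"
      using interior_subset by (intro le) auto
    then have "t * (A\<^sup>2 + B\<^sup>2) \<le> 0"
      using zero by (simp add: algebra_simps power2_eq_square)
    then show ?case
      using elim by (simp add: mult_le_0_iff)
  qed
  then have "A\<^sup>2 + B\<^sup>2 \<le> 0"
    by simp
  then have "A = 0" "B = 0"
    by (simp_all add: sum_power2_le_zero_iff)
  then have "x = z" "y = w"
    using pos xy_pos by (auto simp: A_def B_def)
  then show "(z, w) \<in> polygon"
    using v(1) xy by simp
qed

text \<open>No third line passes through the crossing, so the active lines on either side of p / (p
  + q) are among i and j. Both of their values are critical, which excludes equality.\<close>

lemma interior_cone_Omega_generic: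
  assumes ij: "(i, j) \<in> Omega_pairs m a b" and pq: "p > 0" "q > 0" and generic: "p / (p + q) \<notin> critical"
    and int: "(p, q) \<in> interior (cone_Omega m a b i j)" and zw: "crossing_point a b i j = (z, w)"
  shows "a i * z < p / (p + q) \<and> p / (p + q) < a j * z \<or> a j * z < p / (p + q) \<and> p / (p + q) < a i * z"
    and "\<And>l. l \<in> {1..m} - {i, j} \<Longrightarrow> a l * z + b l * w < 1"
proof -
  note v = interior_cone_Omega_crossing[OF ij pq int zw]
  have ij': "i \<in> {1..m}" "j \<in> {1..m}" "i \<noteq> j" and pos: "z > 0" "w > 0"
    using ij zw by (auto simp: Omega_pairs_def)
  note eqs = crossing_point_on_lines[OF ij' zw]
  have inactive: "a l * z + b l * w \<noteq> 1" if "l \<in> {1..m} - {i, j}" for l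
    using no_triple[OF ij'(1,2), of l z w] ij'(3) eqs that by auto
  then show "a l * z + b l * w < 1" if "l \<in> {1..m} - {i, j}" for l
    using v(1) that by (force simp: polygon_def)
  obtain k l where k: "k \<in> {1..m}" "a k * z + b k * w = 1" "a k * z \<le> p / (p + q)"
    and l: "l \<in> {1..m}" "a l * z + b l * w = 1" "p / (p + q) \<le> a l * z"
    using maximizer_active_lines[OF v(1) pos pq v(2)] by blast
  have kl: "k \<in> {i, j}" "l \<in> {i, j}"
    using inactive k l by blast+
  have "a i * z \<in> critical" "a j * z \<in> critical"
    using critical_I[OF ij' eqs] critical_I[OF ij'(2,1) _ eqs(2,1)] ij'(3) by auto
  then have "a i * z \<noteq> p / (p + q)" "a j * z \<noteq> p / (p + q)"
    using generic by auto
  then show "a i * z < p / (p + q) \<and> p / (p + q) < a j * z \<or> a j * z < p / (p + q) \<and> p / (p + q) < a i * z"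
    using kl k l by auto
qed

text \<open>On a segment through the crossing the slacks of both lines are nonnegative and average
  to 0, so both endpoints lie on both lines. This is what makes the hypothesis on P at vertices
  applicable.\<close>

lemma crossing_extreme_point:
  assumes v: "(z, w) \<in> polygon" and ij: "i \<in> {1..m}" "j \<in> {1..m}" "i \<noteq> j"
    and eqs: "a i * z + b i * w = 1" "a j * z + b j * w = 1"
  shows "(z, w) extreme_point_of polygon"
  unfolding extreme_point_of_def
proof (intro conjI ballI notI v)
  fix u u' assume u: "u \<in> polygon" "u' \<in> polygon" and seg: "(z, w) \<in> open_segment u u'"
  obtain x y x' y' where xy: "u = (x, y)" "u' = (x', y')"
    by force
  from seg obtain t where t: "0 < t" "t < 1" and ne: "u \<noteq> u'"
    and zw: "z = (1 - t) * x + t * x'" "w = (1 - t) * y + t * y'"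
    by (auto simp: in_segment xy)
  have "a l * x + b l * y = 1 \<and> a l * x' + b l * y' = 1" if l: "l \<in> {1..m}" "a l * z + b l * w = 1" for l
  proof -
    define r r' where "r = 1 - (a l * x + b l * y)" and "r' = 1 - (a l * x' + b l * y')"
    have "r \<ge> 0" "r' \<ge> 0"
      using u l by (auto simp: polygon_def xy r_def r'_def)
    moreover have "(1 - t) * r + t * r' = 0"
      using l(2) unfolding zw r_def r'_def by (simp add: algebra_simps)
    ultimately have "(1 - t) * r = 0" "t * r' = 0"
      using t by (auto simp: add_nonneg_eq_0_iff)
    then show ?thesis
      using t by (auto simp: r_def r'_def)
  qed
  then have "crossing_point a b i j = u" "crossing_point a b i j = u'"
    using ij eqs unfolding xy by (auto intro!: crossing_point_eqI)
  with ne show False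
    by simp
qed

end

section \<open>Zeros of P on the lines\<close>

lemma poly_poly_eval2: "poly (poly P c) z = eval2 P z (poly c z)"
  by (induction P) (simp_all add: eval2_def)

text \<open>Substituting w = (1 - \<alpha> z) / \<beta> is evaluation of the outer polynomial at a
  root. Were the result 0, the monic linear factor in w, an associate of \<open>lin_poly\<close>,
  would divide both P and Q.\<close>

lemma not_vanishing_on_line:
  assumes "coprime P Q" "lin_poly \<alpha> \<beta> dvd Q" "\<beta> \<noteq> 0"
  shows "poly P [:1 / of_real \<beta>, - of_real \<alpha> / of_real \<beta>:] \<noteq> 0"
proof
  let ?c = "[:1 / of_real \<beta>, - of_real \<alpha> / of_real \<beta>:] :: complex poly"
  assume "poly P ?c = 0"
  then have "[:- ?c, 1:] dvd P"
    by (simp only: poly_eq_0_iff_dvd)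
  moreover have "lin_poly \<alpha> \<beta> = smult [:- of_real \<beta>:] [:- ?c, 1:]"
    using assms(3) by (simp add: lin_poly_def one_pCons)
  then have "[:- ?c, 1:] dvd lin_poly \<alpha> \<beta>"
    by (metis dvd_smult dvd_refl)
  then have "[:- ?c, 1:] dvd Q"
    using assms(2) dvd_trans by blast
  ultimately have "is_unit [:- ?c, 1:]"
    using assms(1) by (rule coprime_common_divisor[rotated])
  then show False
    by (simp add: is_unit_poly_iff)
qed

text \<open>The parameter t is p / (p + q) when the point is the tangency point of (p, q), so each
  zero costs a single ray of directions.\<close>

lemma finite_zeros_on_line:
  assumes "coprime P Q" "lin_poly \<alpha> \<beta> dvd Q" "\<alpha> \<noteq> 0" "\<beta> \<noteq> 0"
  shows "finite {t :: real. eval2 P (of_real (t / \<alpha>)) (of_real ((1 - t) / \<beta>)) = 0}"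
proof (rule finite_subset)
  let ?R = "poly P [:1 / of_real \<beta>, - of_real \<alpha> / of_real \<beta>:] :: complex poly"
  let ?g = "\<lambda>t. complex_of_real (t / \<alpha>)"
  show "{t :: real. eval2 P (of_real (t / \<alpha>)) (of_real ((1 - t) / \<beta>)) = 0} \<subseteq> ?g -` {z. poly ?R z = 0}"
    using assms(3,4) by (auto simp: poly_poly_eval2 diff_divide_distrib)
  show "finite (?g -` {z. poly ?R z = 0})"
    using not_vanishing_on_line[OF assms(1,2,4)] assms(3)
    by (intro finite_vimageI poly_roots_finite) (auto simp: inj_on_def)
qed

section \<open>From limits to the asymptotic formula\<close>

text \<open>The factor z w in the constant compensates the exponents x + 1 and y + 1 of the main
  term.\<close>

lemma ratio_equivI:
  fixes f :: "nat \<Rightarrow> complex"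
  assumes lim: "(\<lambda>k. s k * (f k * z ^ X k * w ^ Y k)) \<longlonglongrightarrow> C * (R / D)"
    and nz: "C \<noteq> 0" "R \<noteq> 0" "D \<noteq> 0" "z \<noteq> 0" "w \<noteq> 0"
  shows "ratio_equiv f (\<lambda>k. C * z * w / D / s k * (R / (z ^ (X k + 1) * w ^ (Y k + 1))))"
proof -
  have lim': "(\<lambda>k. s k * (f k * z ^ X k * w ^ Y k) / (C * (R / D))) \<longlonglongrightarrow> C * (R / D) / (C * (R / D))"
    using lim nz by (intro tendsto_divide) auto
  \<comment> \<open>\<open>s k\<close> can be 0, as sqrt k is for k = 0; both sides are then 0 by
    the convention for division.\<close>
  have eq: "s k * (f k * z ^ X k * w ^ Y k) / (C * (R / D)) =
      f k / (C * z * w / D / s k * (R / (z ^ (X k + 1) * w ^ (Y k + 1))))" for k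
    using nz by (cases "s k = 0") (simp_all add: field_simps)
  have "C * (R / D) / (C * (R / D)) = 1"
    using nz by simp
  with lim' show ?thesis
    unfolding eq ratio_equiv_def by simp
qed

theorem mainTheorem1:
  fixes P Q :: "complex poly poly"
    and f :: "nat \<Rightarrow> nat \<Rightarrow> complex"
    and m :: nat
    and a b :: "nat \<Rightarrow> real"
  assumes "coprime P Q"
    and "eval2 Q 0 0 \<noteq> 0"
    and "taylor_coeffs_at_origin f (\<lambda>z w. eval2 P z w / eval2 Q z w)"
    and "m \<ge> 1"
    and "Q = (\<Prod>i=1..m. lin_poly (a i) (b i))"
    and "\<forall>i\<in>{1..m}. \<forall>j\<in>{1..m}. i \<noteq> j \<longrightarrow>
           (\<exists>!v. v \<in> cline (a i) (b i) \<inter> cline (a j) (b j))"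
    and "\<forall>i\<in>{1..m}. \<forall>j\<in>{1..m}. \<forall>l\<in>{1..m}. i \<noteq> j \<and> i \<noteq> l \<and> j \<noteq> l \<longrightarrow>
           cline (a i) (b i) \<inter> cline (a j) (b j) \<inter> cline (a l) (b l) = {}"
    and "\<forall>i\<in>{1..m}. a i > 0 \<and> b i > 0"
    and "\<forall>z w. (z, w) extreme_point_of closure (polygon_M m a b) \<and> z \<noteq> 0 \<and> w \<noteq> 0 \<longrightarrow>
           eval2 P (of_real z) (of_real w) \<noteq> 0"
  shows "\<exists>(D :: (real \<times> real) set) (cK :: nat \<Rightarrow> nat \<Rightarrow> complex) (cOmega :: nat \<Rightarrow> nat \<Rightarrow> complex).
           finite D \<and> 0 \<notin> D \<and>
           (\<forall>p q. (real p, real q) \<notin> (\<Union>d\<in>D. origin_ray d) \<longrightarrow>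
              ((\<exists>i\<in>{1..m}. (real p, real q) \<in> interior (cone_K m a b i)) \<or>
               (\<exists>(i, j)\<in>Omega_pairs m a b. (real p, real q) \<in> interior (cone_Omega m a b i j))) \<and>
              (\<forall>i\<in>{1..m}. (real p, real q) \<in> interior (cone_K m a b i) \<longrightarrow>
                 ratio_equiv (\<lambda>k. f (k * p) (k * q))
                   (\<lambda>k. cK p q / of_real (sqrt (real k)) *
                        main_term P (line_point (a i) (b i) (real p, real q)) (k * p) (k * q))) \<and>
              (\<forall>(i, j)\<in>Omega_pairs m a b. (real p, real q) \<in> interior (cone_Omega m a b i j) \<longrightarrow>
                 ratio_equiv (\<lambda>k. f (k * p) (k * q))
                   (\<lambda>k. cOmega i j * main_term P (crossing_point a b i j) (k * p) (k * q))))"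
proof -
  interpret line_arrangement m a b
  proof
    show "a i > 0 \<and> b i > 0" if "i \<in> {1..m}" for i
      using assms(8) that by blast
    show "a i * b j \<noteq> a j * b i" if ij: "i \<in> {1..m}" "j \<in> {1..m}" "i \<noteq> j" for i j
    proof
      assume par: "a i * b j = a j * b i"
      obtain z w where zw: "(z, w) \<in> cline (a i) (b i) \<inter> cline (a j) (b j)"
        and unique: "\<And>v. v \<in> cline (a i) (b i) \<inter> cline (a j) (b j) \<Longrightarrow> v = (z, w)"
        using assms(6) ij by (metis surj_pair)
      have par': "complex_of_real (a i) * of_real (b j) = of_real (a j) * of_real (b i)"
        by (simp only: par flip: of_real_mult)
      \<comment> \<open>Parallel lines share the direction (b, -a), so a common point can be moved
        to a second one.\<close>
      have "(z + of_real (b i), w - of_real (a i)) \<in> cline (a i) (b i) \<inter> cline (a j) (b j)"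
        using zw par' by (simp add: cline_def eval2_lin_poly algebra_simps)
      from unique[OF this] show False
        using assms(8) ij by force
    qed
    show "a l * z + b l * w \<noteq> 1"
      if "i \<in> {1..m}" "j \<in> {1..m}" "l \<in> {1..m}" "i \<noteq> j" "i \<noteq> l" "j \<noteq> l"
        "a i * z + b i * w = 1" "a j * z + b j * w = 1" for i j l z w
    proof
      assume "a l * z + b l * w = 1"
      moreover have "(of_real z, of_real w) \<in> cline (a i) (b i)" if "a i * z + b i * w = 1" for i
      proof -
        have "1 - complex_of_real (a i) * of_real z - of_real (b i) * of_real w = of_real (1 - (a i * z + b i * w))"
          by simp
        then show ?thesis
          using that by (simp add: cline_def eval2_lin_poly)
      qed
      ultimately show False
        using assms(7) that by blast
    qed
  qed (use assms(4) in auto)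
  define R where "R L z w = (\<Prod>l\<in>L. 1 - complex_of_real (a l) * of_real z - of_real (b l) * of_real w)" for L and z w :: real
  have R_nonzero: "R L z w \<noteq> 0" if "finite L" "\<And>l. l \<in> L \<Longrightarrow> a l * z + b l * w < 1" for L z w
  proof -
    have "1 - complex_of_real (a l) * of_real z - of_real (b l) * of_real w = of_real (1 - (a l * z + b l * w))" for l
      by simp
    moreover have "1 - (a l * z + b l * w) \<noteq> 0" if "l \<in> L" for l
      using \<open>\<And>l. l \<in> L \<Longrightarrow> a l * z + b l * w < 1\<close>[OF that] by simp
    ultimately show ?thesis
      unfolding R_def using \<open>finite L\<close> by (simp only: prod_zero_iff of_real_eq_0_iff) blast
  qed
  have "eval2 Q z w = (\<Prod>l\<in>{1..m}. 1 - of_real (a l) * z - of_real (b l) * w)" for z w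
    unfolding assms(5) by (simp add: eval2_def poly_prod flip: eval2_lin_poly)
  with assms(3) have taylor: "taylor_coeffs_at_origin f
      (\<lambda>z w. eval2 P z w / (\<Prod>l\<in>{1..m}. 1 - of_real (a l) * z - of_real (b l) * w))"
    by simp
  define zeros where "zeros i = {t :: real. eval2 P (of_real (t / a i)) (of_real ((1 - t) / b i)) = 0}" for i
  have finite_zeros: "finite (zeros i)" if "i \<in> {1..m}" for i
    unfolding zeros_def using that coeff_pos[OF that] assms(5)
    by (intro finite_zeros_on_line[OF assms(1)]) (auto intro: dvd_prodI)
  \<comment> \<open>The excluded values of p / (p + q): 0 and 1 are the axes, the critical values
    separate the cones, and at a zero of P the main term would vanish.\<close>
  define \<Theta> where "\<Theta> = {0, 1} \<union> critical \<union> (\<Union>i\<in>{1..m}. zeros i)"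
  \<comment> \<open>The ray of directions with p / (p + q) = t passes through (t, 1 - t). Each ray
    contains the origin, so p = q = 0 is excluded as well.\<close>
  define D where "D = (\<lambda>t :: real. (t, 1 - t)) ` \<Theta>"
  have finite_D: "finite D"
    unfolding D_def \<Theta>_def using finite_critical finite_zeros by blast
  have zero_D: "0 \<notin> D"
    by (auto simp: D_def zero_prod_def)
  have off_D: "p > 0" "q > 0" "real p / (real p + real q) \<notin> \<Theta>"
    if off: "(real p, real q) \<notin> (\<Union>d\<in>D. origin_ray d)" for p q
  proof -
    have ray: "(s * t, s * (1 - t)) \<noteq> (real p, real q)" if "t \<in> \<Theta>" "s \<ge> 0" for s t
      using off that by (force simp: D_def origin_ray_def)
    show "p > 0" "q > 0"
      using ray[of 0 "real q"] ray[of 1 "real p"] by (auto simp: \<Theta>_def intro: gr0I)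
    then show "real p / (real p + real q) \<notin> \<Theta>"
      using ray[of "real p / (real p + real q)" "real p + real q"] by (auto simp: field_simps)
  qed
  have line_case: "\<exists>c. ratio_equiv (\<lambda>k. f (k * p) (k * q))
      (\<lambda>k. c / of_real (sqrt (real k)) * main_term P (line_point (a i) (b i) (real p, real q)) (k * p) (k * q))"
    if off: "(real p, real q) \<notin> (\<Union>d\<in>D. origin_ray d)" and i: "i \<in> {1..m}"
      and K: "(real p, real q) \<in> cone_K m a b i" for p q i
  proof -
    have pq: "p > 0" "q > 0" and pq': "real p > 0" "real q > 0" and \<theta>: "real p / (real p + real q) \<notin> \<Theta>"
      using off_D[OF off] by auto
    obtain z w where zw: "line_point (a i) (b i) (real p, real q) = (z, w)"
      by force
    note line = line_point_on_line[OF i pq' zw]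
    have less: "a l * z + b l * w < 1" if "l \<in> {1..m} - {i}" for l
      using cone_K_strict[OF i pq' K _ that zw] \<theta> by (simp add: \<Theta>_def)
    obtain c where c: "c > 0" "(\<lambda>k. of_real (sqrt (real k)) * (f (k * p) (k * q) * of_real z ^ (k * p) * of_real w ^ (k * q)))
      \<longlonglongrightarrow> of_real c * (eval2 P (of_real z) (of_real w) / R ({1..m} - {i}) z w)"
      unfolding R_def by (rule taylor_ray_asymp_line[OF taylor _ coeff_pos i pq, of z w]) (use line less in auto)
    have "eval2 P (of_real z) (of_real w) \<noteq> 0"
    proof -
      have "z = (real p / (real p + real q)) / a i" "w = (1 - real p / (real p + real q)) / b i"
        using zw pq by (auto simp: line_point_def field_simps)
      then show ?thesis
        using \<theta> i by (auto simp: \<Theta>_def zeros_def)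
    qed
    moreover have "R ({1..m} - {i}) z w \<noteq> 0"
      using less by (intro R_nonzero) auto
    ultimately have "ratio_equiv (\<lambda>k. f (k * p) (k * q))
        (\<lambda>k. of_real c * of_real z * of_real w / R ({1..m} - {i}) z w / of_real (sqrt (real k)) *
          main_term P (line_point (a i) (b i) (real p, real q)) (k * p) (k * q))"
      using ratio_equivI[OF c(2)] c(1) line(1,2) by (simp add: main_term_def zw)
    then show ?thesis
      by (rule exI)
  qed
  \<comment> \<open>The constant may depend on p and q only, so a single c is required for all i at
    once; \<open>cone_K_unique\<close> makes this possible.\<close>
  define on_line where "on_line p q c \<longleftrightarrow> (\<forall>i\<in>{1..m}. (real p, real q) \<in> interior (cone_K m a b i) \<longrightarrow>
      ratio_equiv (\<lambda>k. f (k * p) (k * q))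
        (\<lambda>k. c / of_real (sqrt (real k)) * main_term P (line_point (a i) (b i) (real p, real q)) (k * p) (k * q)))"
    for p q c
  have on_line_exists: "\<exists>c. on_line p q c" if off: "(real p, real q) \<notin> (\<Union>d\<in>D. origin_ray d)" for p q
  proof (cases "\<exists>i\<in>{1..m}. (real p, real q) \<in> cone_K m a b i")
    case True
    then obtain i where i: "i \<in> {1..m}" "(real p, real q) \<in> cone_K m a b i"
      by blast
    have pq': "real p > 0" "real q > 0" and \<theta>: "real p / (real p + real q) \<notin> critical"
      using off_D[OF off] by (auto simp: \<Theta>_def)
    have unique: "j = i" if "j \<in> {1..m}" "(real p, real q) \<in> interior (cone_K m a b j)" for j
      by (rule cone_K_unique[OF that(1) i(1) pq' \<theta> subsetD[OF interior_subset that(2)] i(2)])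
    obtain c where c: "ratio_equiv (\<lambda>k. f (k * p) (k * q))
        (\<lambda>k. c / of_real (sqrt (real k)) * main_term P (line_point (a i) (b i) (real p, real q)) (k * p) (k * q))"
      using line_case[OF off i] by (elim exE)
    have "on_line p q c"
      unfolding on_line_def
    proof (intro ballI impI)
      fix j assume "j \<in> {1..m}" "(real p, real q) \<in> interior (cone_K m a b j)"
      then have "j = i"
        by (rule unique)
      show "ratio_equiv (\<lambda>k. f (k * p) (k * q))
          (\<lambda>k. c / of_real (sqrt (real k)) * main_term P (line_point (a j) (b j) (real p, real q)) (k * p) (k * q))"
        unfolding \<open>j = i\<close> by (rule c)
    qed
    then show ?thesis
      by (rule exI)
  next
    case False
    \<comment> \<open>The requirement is vacuous here, so 0 is an arbitrary default.\<close>
    have "on_line p q 0"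
      unfolding on_line_def
    proof (intro ballI impI, rule ccontr)
      fix i assume "i \<in> {1..m}" "(real p, real q) \<in> interior (cone_K m a b i)"
      with False subsetD[OF interior_subset] show False
        by blast
    qed
    then show ?thesis
      by (rule exI)
  qed
  define cK where "cK p q = (SOME c. on_line p q c)" for p q
  have cK: "on_line p q (cK p q)" if "(real p, real q) \<notin> (\<Union>d\<in>D. origin_ray d)" for p q
    unfolding cK_def using on_line_exists[OF that] by (rule someI_ex)
  \<comment> \<open>The limit of the rescaled kernel, the factor z w from the exponents, and the
    remaining linear factors at the vertex: everything is determined by the crossing, independently
    of p and q.\<close>
  define cOmega where "cOmega i j = (let (z, w) = crossing_point a b i j in
      of_real (1 / \<bar>a i * z - a j * z\<bar>) * of_real z * of_real w / R ({1..m} - {i, j}) z w)" for i j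
  have vertex_case: "ratio_equiv (\<lambda>k. f (k * p) (k * q))
      (\<lambda>k. cOmega i j * main_term P (crossing_point a b i j) (k * p) (k * q))"
    if off: "(real p, real q) \<notin> (\<Union>d\<in>D. origin_ray d)" and ij: "(i, j) \<in> Omega_pairs m a b"
      and int: "(real p, real q) \<in> interior (cone_Omega m a b i j)" for p q i j
  proof -
    have pq: "p > 0" "q > 0" and pq': "real p > 0" "real q > 0" and \<theta>: "real p / (real p + real q) \<notin> critical"
      using off_D[OF off] by (auto simp: \<Theta>_def)
    obtain z w where zw: "crossing_point a b i j = (z, w)"
      by force
    have ij': "i \<in> {1..m}" "j \<in> {1..m}" "i \<noteq> j" and pos: "z > 0" "w > 0"
      using ij zw by (auto simp: Omega_pairs_def)
    note eqs = crossing_point_on_lines[OF ij' zw]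
    note generic = interior_cone_Omega_generic[OF ij pq' \<theta> int zw]
    have lim: "(\<lambda>k. 1 * (f (k * p) (k * q) * of_real z ^ (k * p) * of_real w ^ (k * q)))
      \<longlonglongrightarrow> of_real (1 / \<bar>a i * z - a j * z\<bar>) * (eval2 P (of_real z) (of_real w) / R ({1..m} - {i, j}) z w)"
      unfolding R_def mult_1
      by (rule taylor_ray_asymp_vertex[OF taylor _ coeff_pos ij' pq pos eqs]) (use generic in auto)
    have "(z, w) extreme_point_of closure (polygon_M m a b)"
      unfolding closure_polygon_M
      using interior_cone_Omega_crossing(1)[OF ij pq' int zw] by (rule crossing_extreme_point[OF _ ij' eqs])
    then have "eval2 P (of_real z) (of_real w) \<noteq> 0"
      using assms(9) pos by auto
    moreover have "R ({1..m} - {i, j}) z w \<noteq> 0"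
      using generic(2) by (intro R_nonzero) auto
    moreover have "a i * z - a j * z \<noteq> 0"
      using generic(1) by auto
    ultimately show ?thesis
      using ratio_equivI[OF lim] pos by (simp add: main_term_def zw cOmega_def)
  qed
  have in_interior: "(\<exists>i\<in>{1..m}. (real p, real q) \<in> interior (cone_K m a b i)) \<or>
      (\<exists>(i, j)\<in>Omega_pairs m a b. (real p, real q) \<in> interior (cone_Omega m a b i j))"
    if "(real p, real q) \<notin> (\<Union>d\<in>D. origin_ray d)" for p q
    using off_D[OF that] by (intro generic_in_interior) (auto simp: \<Theta>_def)
  show ?thesis
  proof (rule exI[of _ D], rule exI[of _ cK], rule exI[of _ cOmega], intro conjI allI impI)
    show "finite D" "0 \<notin> D"
      by (fact finite_D zero_D)+
    fix p q assume off: "(real p, real q) \<notin> (\<Union>d\<in>D. origin_ray d)"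
    show "(\<exists>i\<in>{1..m}. (real p, real q) \<in> interior (cone_K m a b i)) \<or>
        (\<exists>(i, j)\<in>Omega_pairs m a b. (real p, real q) \<in> interior (cone_Omega m a b i j))"
      by (rule in_interior[OF off])
    show "\<forall>i\<in>{1..m}. (real p, real q) \<in> interior (cone_K m a b i) \<longrightarrow>
        ratio_equiv (\<lambda>k. f (k * p) (k * q))
          (\<lambda>k. cK p q / of_real (sqrt (real k)) *
            main_term P (line_point (a i) (b i) (real p, real q)) (k * p) (k * q))"
      by (rule cK[OF off, unfolded on_line_def])
    show "\<forall>(i, j)\<in>Omega_pairs m a b. (real p, real q) \<in> interior (cone_Omega m a b i j) \<longrightarrow>
        ratio_equiv (\<lambda>k. f (k * p) (k * q))
          (\<lambda>k. cOmega i j * main_term P (crossing_point a b i j) (k * p) (k * q))"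
      by (rule ballI, clarify) (rule vertex_case[OF off])
  qed
qed

end
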